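(* Let $m\ge2$ be an integer, $c\ge0$ and $\alpha>-1$. For each integer $k\ge0$ let $\{Y_k^i\}_{i=1}^{d_{k,m}}$ be an orthonormal basis for $M_l^+(k)$. Then the even eigenfunctions of the operator $\mathcal{L}_{c,\alpha}$, i.e. $\{\psi_{2N,m,\alpha}^{k,c,i}:N\ge0,\ k\ge0,\ 1\le i\le d_{k,m}\}$, are orthogonal in $L^2_\alpha(B(1),\mathbb{C}_m)$: $$\int_{B(1)}\overline{\psi_{2N,m,\alpha}^{k,c,i}(x)}\,\psi_{2N',m,\alpha}^{k',c,i'}(x)\,(1-|x|^2)^\alpha\,dx=0\qquad\text{whenever }(N,k,i)\ne(N',k',i').$$
   Context: $\mathbb{R}_m$ is the real Clifford algebra generated by $e_1,\dots,e_m$ with $e_j^2=-1$ and $e_ie_j=-e_je_i$ for $i\neq j$; $\mathbb{C}_m$ is its complexification. A point of $\mathbb{R}^m$ is identified with the Clifford vector $x=\sum_{j=1}^m e_jx_j$. Hermitian conjugation $\lambda\mapsto\bar\lambda$ satisfies $\overline{\lambda\mu}=\bar\mu\bar\lambda$, $\overline{e_j}=-e_j$ (and is complex conjugation on scalars). The Dirac operator is $\partial_x f=\sum_{j=1}^m e_j\,\partial f/\partial x_j$. $M_l^+(k)$ is the set of homogeneous polynomials $Y_k:\mathbb{R}^m\to\mathbb{R}_m$ of degree $k$ with $\partial_xY_k=0$, of dimension $d_{k,m}=\binom{m+k-2}{k}$ (as a right Clifford module); an orthonormal basis $\{Y_k^i\}$ is one with $\int_{S^{m-1}}\overline{Y_k^i(\omega)}Y_k^{i'}(\omega)\,d\omega=\delta_{ii'}$.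 $B(1)$ is the unit ball of $\mathbb{R}^m$, and $L^2_\alpha(B(1),\mathbb{C}_m)$ is the right Hilbert Clifford-module of measurable $f:B(1)\to\mathbb{C}_m$ with $\int_{B(1)}|f|^2(1-|x|^2)^\alpha dx<\infty$, with Clifford-valued inner product $\langle f,g\rangle_\alpha=\int_{B(1)}\overline{f(x)}g(x)(1-|x|^2)^\alpha dx$. The weighted Clifford prolate spheroidal wave functions (weighted CPSWFs) are the eigenfunctions on $B(1)$ of $$\mathcal{L}_{c,\alpha}f(x)=(1-|x|^2)^{-\alpha}\,\partial_x\big((1-|x|^2)^{\alpha+1}\,\partial_xf(x)\big)+4\pi^2c^2|x|^2f(x).$$ The even ones attached to $Y_k^i$ are the eigenfunctions of the form $F(|x|^2)Y_k^i(x)$ with $F\in C^\infty([0,1],\mathbb{R})$, $F\not\equiv0$ (the admissible $F$ and eigenvalues do not depend on $i$). They are enumerated, up to nonzero real scalar multiples, by $N=0,1,2,\dots$ in order of increasing eigenvalue, and written $\psi_{2N,m,\alpha}^{k,c,i}(x)=P_{N,m,\alpha}^{k,c}(|x|^2)Y_k^i(x)$. *)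

theory Defs
  imports "HOL-Analysis.Analysis"
begin

section \<open>Complexified Clifford algebra\<close>

text \<open>
  The generators are indexed by a finite type \<open>'n\<close>, so \<open>m = CARD('n)\<close>. An element of the
  complexified algebra is the family of its coefficients with respect to the basis of blades
  \<open>e_A = e_{j1} \<cdots> e_{jr}\<close> with \<open>A = {j1 < \<dots> < jr}\<close>; the linear order on \<open>'n\<close> only serves to fix
  this ordering. The norm inherited from the type is \<open>|a|\<^sup>2 = (\<Sum>A. |a_A|\<^sup>2)\<close>. The multiplication
  \<open>*\<close> that the library puts on this type is componentwise and is not the Clifford product.
\<close>

type_synonym 'n point = "real ^ 'n"

type_synonym 'n multivector = "complex ^ ('n set)"

text \<open>\<open>e_A e_B = blade_sign A B \<cdot> e_{A \<triangle> B}\<close>: moving \<open>e_j\<close> past \<open>e_i\<close> with \<open>j < i\<close> costs a sign,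
  and so does \<open>e_i e_i = -1\<close>.\<close>

definition blade_sign :: "'n::{finite,linorder} set \<Rightarrow> 'n set \<Rightarrow> complex" where
  "blade_sign A B = (\<Prod>i\<in>A. \<Prod>j\<in>B. if j \<le> i then -1 else 1)"

definition cl_mult :: "'n::{finite,linorder} multivector \<Rightarrow> 'n multivector \<Rightarrow> 'n multivector"
    (infixl "\<odot>" 70) where
  "a \<odot> b = (\<chi> C. \<Sum>A\<in>UNIV. blade_sign A (sym_diff A C) * a $ A * b $ (sym_diff A C))"

definition cl_one :: "'n::finite multivector" where
  "cl_one = axis {} 1"

definition cl_e :: "'n::finite \<Rightarrow> 'n multivector" where
  "cl_e j = axis {j} 1"

text \<open>Hermitian conjugation is antimultiplicative with \<open>e_j \<mapsto> -e_j = e_j\<inverse>\<close>, so it sends \<open>e_A\<close> to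
  \<open>e_A\<inverse>\<close>, and \<open>e_A e_A = blade_sign A A = \<plusminus>1\<close>.\<close>

definition cl_conj :: "'n::{finite,linorder} multivector \<Rightarrow> 'n multivector" where
  "cl_conj a = (\<chi> A. blade_sign A A * cnj (a $ A))"

definition cl_real :: "'n::finite multivector set" where
  "cl_real = {a. \<forall>A. a $ A \<in> \<real>}"

subsection \<open>The structure above is the Clifford algebra\<close>

lemma blade_sign_sq: "blade_sign A B * blade_sign A B = 1"
  by (simp add: blade_sign_def flip: prod.distrib) (auto intro!: prod.neutral)

lemma prod_sym_diff:
  fixes f :: "'a::finite \<Rightarrow> complex"
  assumes "\<And>i. f i * f i = 1"
  shows "prod f (sym_diff A B) = prod f A * prod f B"
proof -
  have 1: "prod f A = prod f (A - B) * prod f (A \<inter> B)" for A B :: "'a set"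
    by (metis Diff_Diff_Int Diff_subset finite prod.subset_diff mult.commute)
  have 2: "prod f (A \<inter> B) * prod f (A \<inter> B) = 1"
    by (simp add: assms flip: prod.distrib)
  have "prod f (sym_diff A B) = prod f (A - B) * prod f (B - A)"
    by (rule prod.union_disjoint) auto
  also have "\<dots> = prod f A * prod f B"
    using 1[of A B] 1[of B A] 2 by (simp add: Int_commute algebra_simps)
  finally show ?thesis .
qed

lemma blade_sign_sym_diff_left:
  "blade_sign (sym_diff A B) C = blade_sign A C * blade_sign B C"
  unfolding blade_sign_def by (rule prod_sym_diff) (auto simp flip: prod.distrib intro!: prod.neutral)

lemma blade_sign_sym_diff_right:
  "blade_sign A (sym_diff B C) = blade_sign A B * blade_sign A C"
  unfolding blade_sign_def by (subst prod_sym_diff) (auto simp: prod.distrib)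

lemma cl_mult_axis:
  "axis A x \<odot> axis B y = axis (sym_diff A B) (blade_sign A B * x * y)"
proof (rule vec_eq_iff[THEN iffD2], rule allI)
  fix C
  have "(axis A x \<odot> axis B y) $ C
      = (\<Sum>A'\<in>{A}. blade_sign A' (sym_diff A' C) * axis A x $ A' * axis B y $ (sym_diff A' C))"
    unfolding cl_mult_def vec_lambda_beta by (rule sum.mono_neutral_right) (auto simp: axis_def)
  moreover have "sym_diff A C = B \<longleftrightarrow> C = sym_diff A B" by blast
  ultimately show "(axis A x \<odot> axis B y) $ C = axis (sym_diff A B) (blade_sign A B * x * y) $ C"
    by (auto simp: axis_def)
qed

lemma cl_e_square: "cl_e j \<odot> cl_e j = - cl_one"
  unfolding cl_e_def cl_one_def cl_mult_axis
  by (simp add: blade_sign_def axis_def vec_eq_iff)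

lemma cl_e_anticommute: "i \<noteq> j \<Longrightarrow> cl_e i \<odot> cl_e j = - (cl_e j \<odot> cl_e i)"
  unfolding cl_e_def cl_mult_axis Un_commute[of "{i} - {j}"]
  by (auto simp: blade_sign_def axis_def vec_eq_iff)

lemma cl_blade_insert:
  assumes "\<And>i. i \<in> A \<Longrightarrow> j < i"
  shows "axis (insert j A) 1 = (cl_e j :: 'n::{finite,linorder} multivector) \<odot> axis A 1"
proof -
  have "blade_sign {j} A = 1"
    using assms by (force simp: blade_sign_def intro!: prod.neutral)
  moreover have "sym_diff {j} A = insert j A"
    using assms by auto
  ultimately show ?thesis
    by (simp add: cl_e_def cl_mult_axis)
qed

lemma cl_mult_one_left: "cl_one \<odot> a = a"
proof (rule vec_eq_iff[THEN iffD2], rule allI)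
  fix C
  have "(cl_one \<odot> a) $ C
      = (\<Sum>A\<in>{{}}. blade_sign A (sym_diff A C) * cl_one $ A * a $ (sym_diff A C))"
    unfolding cl_mult_def vec_lambda_beta by (rule sum.mono_neutral_right) (auto simp: axis_def cl_one_def)
  then show "(cl_one \<odot> a) $ C = a $ C"
    by (simp add: blade_sign_def cl_one_def axis_def)
qed

lemma cl_mult_one_right: "a \<odot> cl_one = a"
proof (rule vec_eq_iff[THEN iffD2], rule allI)
  fix C
  have "(a \<odot> cl_one) $ C
      = (\<Sum>A\<in>{C}. blade_sign A (sym_diff A C) * a $ A * cl_one $ (sym_diff A C))"
    unfolding cl_mult_def vec_lambda_beta by (rule sum.mono_neutral_right) (auto simp: axis_def cl_one_def)
  then show "(a \<odot> cl_one) $ C = a $ C"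
    by (simp add: blade_sign_def cl_one_def axis_def)
qed

lemma cl_mult_assoc:
  fixes a b c :: "'a::{finite,linorder} multivector"
  shows "(a \<odot> b) \<odot> c = a \<odot> (b \<odot> c)"
proof (rule vec_eq_iff[THEN iffD2], rule allI)
  fix D :: "'a set"
  let ?s = blade_sign and ?d = sym_diff
  have "((a \<odot> b) \<odot> c) $ D =
      (\<Sum>C\<in>UNIV. \<Sum>A\<in>UNIV. ?s C (?d C D) * ?s A (?d A C) * a $ A * b $ (?d A C) * c $ (?d C D))"
    unfolding cl_mult_def by (simp add: sum_distrib_left sum_distrib_right mult_ac)
  also have "\<dots> =
      (\<Sum>A\<in>UNIV. \<Sum>C\<in>UNIV. ?s C (?d C D) * ?s A (?d A C) * a $ A * b $ (?d A C) * c $ (?d C D))"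
    by (rule sum.swap)
  also have "\<dots> = (\<Sum>A\<in>UNIV. \<Sum>B\<in>UNIV.
      ?s (?d A B) (?d (?d A B) D) * ?s A B * a $ A * b $ B * c $ (?d (?d A B) D))"
  proof (rule sum.cong[OF refl])
    fix A :: "'a set"
    have dd: "?d A (?d A B) = B" for B by blast
    show "(\<Sum>C\<in>UNIV. ?s C (?d C D) * ?s A (?d A C) * a $ A * b $ (?d A C) * c $ (?d C D))
        = (\<Sum>B\<in>UNIV. ?s (?d A B) (?d (?d A B) D) * ?s A B * a $ A * b $ B * c $ (?d (?d A B) D))"
      by (rule sum.reindex_bij_witness[of _ "?d A" "?d A"]) (simp_all only: dd UNIV_I)
  qed
  also have "\<dots> = (\<Sum>A\<in>UNIV. \<Sum>B\<in>UNIV.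
      ?s A (?d A D) * ?s B (?d B (?d A D)) * a $ A * b $ B * c $ (?d B (?d A D)))"
  proof (intro sum.cong refl)
    fix A B :: "'a set"
    let ?C = "?d B (?d A D)"
    have 1: "?d (?d A B) D = ?C" and 2: "?d A D = ?d B ?C" by blast+
    have "?s A (?d A D) = ?s A B * ?s A ?C"
      by (subst 2) (rule blade_sign_sym_diff_right)
    then show "?s (?d A B) (?d (?d A B) D) * ?s A B * a $ A * b $ B * c $ (?d (?d A B) D)
        = ?s A (?d A D) * ?s B (?d B (?d A D)) * a $ A * b $ B * c $ (?d B (?d A D))"
      by (simp only: 1 blade_sign_sym_diff_left mult_ac)
  qed
  also have "\<dots> = (a \<odot> (b \<odot> c)) $ D"
    unfolding cl_mult_def by (simp add: sum_distrib_left mult_ac)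
  finally show "((a \<odot> b) \<odot> c) $ D = (a \<odot> (b \<odot> c)) $ D" .
qed

lemma cl_conj_e: "cl_conj (cl_e j) = - cl_e j"
  by (simp add: cl_conj_def cl_e_def blade_sign_def axis_def vec_eq_iff)

lemma cl_conj_mult:
  fixes a b :: "'a::{finite,linorder} multivector"
  shows "cl_conj (a \<odot> b) = cl_conj b \<odot> cl_conj a"
proof (rule vec_eq_iff[THEN iffD2], rule allI)
  fix C :: "'a set"
  let ?s = blade_sign and ?d = sym_diff
  have cnj: "cnj (?s A B) = ?s A B" for A B :: "'a set"
    unfolding blade_sign_def by (simp add: if_distrib cong: if_cong)
  have dd: "?d (?d A C) C = A" "?d A (?d A C) = C" for A by blast+
  have "cl_conj (a \<odot> b) $ C
      = (\<Sum>A\<in>UNIV. ?s C C * ?s A (?d A C) * cnj (a $ A) * cnj (b $ (?d A C)))"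
    by (simp add: cl_conj_def cl_mult_def cnj sum_distrib_left mult_ac)
  also have "\<dots> = (\<Sum>A\<in>UNIV. ?s (?d A C) A * (?s (?d A C) (?d A C) * cnj (b $ (?d A C)))
      * (?s A A * cnj (a $ A)))"
  proof (intro sum.cong refl)
    fix A :: "'a set"
    let ?B = "?d A C"
    have "?s (?d A B) (?d A B) = ?s A A * ?s A B * ?s B A * ?s B B" for B
      unfolding blade_sign_sym_diff_left blade_sign_sym_diff_right by (simp only: mult_ac)
    from this[of ?B] have *: "?s C C = ?s A A * ?s A ?B * ?s ?B A * ?s ?B ?B"
      unfolding dd(2) .
    have "?s C C * ?s A ?B = ?s A A * ?s ?B A * ?s ?B ?B * (?s A ?B * ?s A ?B)"
      unfolding * by (simp only: mult_ac)
    then have "?s C C * ?s A ?B = ?s A A * ?s ?B A * ?s ?B ?B"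
      unfolding blade_sign_sq by (simp only: mult_1_right)
    then show "?s C C * ?s A ?B * cnj (a $ A) * cnj (b $ ?B)
        = ?s ?B A * (?s ?B ?B * cnj (b $ ?B)) * (?s A A * cnj (a $ A))"
      by (simp only: mult_ac)
  qed
  also have "\<dots> = (\<Sum>B\<in>UNIV. ?s B (?d B C) * (?s B B * cnj (b $ B))
      * (?s (?d B C) (?d B C) * cnj (a $ (?d B C))))"
    by (rule sum.reindex_bij_witness[of _ "\<lambda>B. ?d B C" "\<lambda>A. ?d A C"]) (simp_all only: dd UNIV_I)
  also have "\<dots> = (cl_conj b \<odot> cl_conj a) $ C"
    by (simp add: cl_conj_def cl_mult_def)
  finally show "cl_conj (a \<odot> b) $ C = (cl_conj b \<odot> cl_conj a) $ C" .
qed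

section \<open>Spherical monogenics\<close>

definition dirac :: "('n point \<Rightarrow> 'n multivector) \<Rightarrow> 'n point \<Rightarrow> 'n::{finite,linorder} multivector"
  where
  "dirac f x = (\<Sum>j\<in>UNIV. cl_e j \<odot> vector_derivative (\<lambda>t. f (x + t *\<^sub>R axis j 1)) (at 0))"

definition homogeneous_polynomial :: "nat \<Rightarrow> ('n::finite point \<Rightarrow> 'n multivector) \<Rightarrow> bool" where
  "homogeneous_polynomial k p \<longleftrightarrow>
     (\<exists>a. \<forall>x. p x = (\<Sum>\<beta> | (\<Sum>j\<in>UNIV. \<beta> j) = k. (\<Prod>j\<in>UNIV. (x $ j) ^ \<beta> j) *\<^sub>R a \<beta>))"

lemma finite_multi_indices: "finite {\<beta>::'n::finite \<Rightarrow> nat. (\<Sum>j\<in>UNIV. \<beta> j) = k}"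
proof (rule finite_subset)
  show "{\<beta>. (\<Sum>j\<in>UNIV. \<beta> j) = k} \<subseteq> Pi\<^sub>E (UNIV :: 'n set) (\<lambda>_. {..k})"
  proof
    fix \<beta> :: "'n \<Rightarrow> nat"
    assume "\<beta> \<in> {\<beta>. (\<Sum>j\<in>UNIV. \<beta> j) = k}"
    moreover have "\<beta> i \<le> (\<Sum>j\<in>UNIV. \<beta> j)" for i
      by (rule member_le_sum) simp_all
    ultimately show "\<beta> \<in> Pi\<^sub>E UNIV (\<lambda>_. {..k})"
      by (simp add: PiE_UNIV_domain)
  qed
  show "finite (Pi\<^sub>E (UNIV :: 'n set) (\<lambda>_. {..k}))"
    by (rule finite_PiE) simp_all
qed

definition monogenics :: "nat \<Rightarrow> ('n point \<Rightarrow> 'n::{finite,linorder} multivector) set" where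
  "monogenics k = {Y. homogeneous_polynomial k Y \<and> (\<forall>x. Y x \<in> cl_real) \<and> (\<forall>x. dirac Y x = 0)}"

text \<open>Surface measure of the unit sphere, normalised by polar coordinates
  \<open>\<integral>\<^bsub>\<real>\<^sup>m\<^esub> g dx = \<integral>\<^sub>0\<^sup>\<infinity> \<integral>\<^bsub>S\<^esub> g(r\<omega>) r\<^bsup>m-1\<^esup> d\<omega> dr\<close>: the area of a subset of the sphere is \<open>m\<close> times
  the volume of the cone over it in the unit ball. As a measure on the whole space it is
  concentrated on \<open>sphere 0 1\<close>, except that for the point \<open>0\<close>, of volume \<open>0\<close>, \<open>sgn 0 = 0\<close>.\<close>

definition sphere_measure :: "('n::finite point) measure" where
  "sphere_measure =
     distr (density lborel (\<lambda>x. ennreal (real CARD('n) * indicator (ball 0 1) x))) borel sgn"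

text \<open>The dimension \<open>d\<^bsub>k,m\<^esub>\<close>.\<close>

definition monogenic_dim :: "'n::finite itself \<Rightarrow> nat \<Rightarrow> nat" where
  "monogenic_dim _ k = (CARD('n) + k - 2) choose k"

text \<open>Orthonormal basis of the right module over the real Clifford algebra; uniqueness of the
  coefficients follows from orthonormality.\<close>

definition monogenic_onb ::
    "nat \<Rightarrow> (nat \<Rightarrow> 'n point \<Rightarrow> 'n::{finite,linorder} multivector) \<Rightarrow> bool" where
  "monogenic_onb k Y \<longleftrightarrow>
     (\<forall>i\<in>{1..monogenic_dim TYPE('n) k}. Y i \<in> monogenics k) \<and>
     (\<forall>i\<in>{1..monogenic_dim TYPE('n) k}. \<forall>i'\<in>{1..monogenic_dim TYPE('n) k}.
        (LINT \<omega>|sphere_measure. cl_conj (Y i \<omega>) \<odot> Y i' \<omega>) = (if i = i' then cl_one else 0)) \<and>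
     (\<forall>Z\<in>monogenics k. \<exists>a. (\<forall>i. a i \<in> cl_real) \<and>
        (\<forall>x. Z x = (\<Sum>i\<in>{1..monogenic_dim TYPE('n) k}. Y i x \<odot> a i)))"

section \<open>Weighted Clifford prolate spheroidal wave functions\<close>

definition ball_weight :: "real \<Rightarrow> 'n::finite point \<Rightarrow> real" where
  "ball_weight \<alpha> x = (1 - (norm x)\<^sup>2) powr \<alpha>"

definition L2_ball :: "real \<Rightarrow> ('n::finite point \<Rightarrow> 'n multivector) set" where
  "L2_ball \<alpha> = {f. set_borel_measurable lebesgue (ball 0 1) f \<and>
     set_integrable lebesgue (ball 0 1) (\<lambda>x. (norm (f x))\<^sup>2 * ball_weight \<alpha> x)}"

definition L2_ball_inner ::
    "real \<Rightarrow> ('n point \<Rightarrow> 'n multivector) \<Rightarrow> ('n point \<Rightarrow> 'n multivector)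
       \<Rightarrow> 'n::{finite,linorder} multivector" where
  "L2_ball_inner \<alpha> f g = (LINT x:ball 0 1|lebesgue. ball_weight \<alpha> x *\<^sub>R (cl_conj (f x) \<odot> g x))"

definition cpswf_operator ::
    "real \<Rightarrow> real \<Rightarrow> ('n point \<Rightarrow> 'n multivector) \<Rightarrow> 'n point \<Rightarrow> 'n::{finite,linorder} multivector"
  where
  "cpswf_operator c \<alpha> f x =
     ball_weight (- \<alpha>) x *\<^sub>R dirac (\<lambda>y. ball_weight (\<alpha> + 1) y *\<^sub>R dirac f y) x
     + (4 * pi\<^sup>2 * c\<^sup>2 * (norm x)\<^sup>2) *\<^sub>R f x"

definition cpswf_eigenfunction ::
    "real \<Rightarrow> real \<Rightarrow> real \<Rightarrow> ('n point \<Rightarrow> 'n::{finite,linorder} multivector) \<Rightarrow> bool" where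
  "cpswf_eigenfunction c \<alpha> \<mu> f \<longleftrightarrow>
     (\<exists>x\<in>ball 0 1. f x \<noteq> 0) \<and> (\<forall>x\<in>ball 0 1. cpswf_operator c \<alpha> f x = \<mu> *\<^sub>R f x)"

text \<open>\<open>C\<^sup>\<infinity>([0,1], \<real>)\<close>, with one-sided derivatives at the end points; values outside \<open>[0,1]\<close> are
  irrelevant.\<close>

definition smooth_unit_interval :: "(real \<Rightarrow> real) \<Rightarrow> bool" where
  "smooth_unit_interval F \<longleftrightarrow> (\<exists>D :: nat \<Rightarrow> real \<Rightarrow> real. (\<forall>t\<in>{0..1}. D 0 t = F t) \<and>
     (\<forall>n. \<forall>t\<in>{0..1}. (D n has_real_derivative D (Suc n) t) (at t within {0..1})))"

definition radial_times ::
    "(real \<Rightarrow> real) \<Rightarrow> ('n point \<Rightarrow> 'n multivector) \<Rightarrow> 'n point \<Rightarrow> 'n::finite multivector" where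
  "radial_times F Y x = F ((norm x)\<^sup>2) *\<^sub>R Y x"

definition even_cpswf_radial ::
    "real \<Rightarrow> real \<Rightarrow> ('n point \<Rightarrow> 'n::{finite,linorder} multivector) \<Rightarrow> real
       \<Rightarrow> (real \<Rightarrow> real) \<Rightarrow> bool" where
  "even_cpswf_radial c \<alpha> Y \<mu> F \<longleftrightarrow>
     smooth_unit_interval F \<and> (\<exists>t\<in>{0..1}. F t \<noteq> 0) \<and> cpswf_eigenfunction c \<alpha> \<mu> (radial_times F Y)"

text \<open>\<open>P 0, P 1, \<dots>\<close> lists the admissible radial factors, one for each class up to nonzero real
  multiples on \<open>[0,1]\<close>, by increasing eigenvalue. Since a list of all classes exists only if the
  eigenvalues are simple, \<open>mono ev\<close> amounts to strict monotonicity.\<close>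

definition even_cpswf_enumeration ::
    "real \<Rightarrow> real \<Rightarrow> ('n point \<Rightarrow> 'n::{finite,linorder} multivector) \<Rightarrow> (nat \<Rightarrow> real \<Rightarrow> real) \<Rightarrow> bool"
  where
  "even_cpswf_enumeration c \<alpha> Y P \<longleftrightarrow>
     (\<exists>ev. mono ev \<and> (\<forall>N. even_cpswf_radial c \<alpha> Y (ev N) (P N))) \<and>
     (\<forall>\<mu> F. even_cpswf_radial c \<alpha> Y \<mu> F \<longrightarrow>
        (\<exists>!N. \<exists>a. a \<noteq> 0 \<and> (\<forall>t\<in>{0..1}. F t = a * P N t)))"

end

theory Submission
  imports Defs
begin

text \<open>
  Write \<open>\<psi> = P(|x|\<^sup>2) Y\<close> with \<open>Y\<close> a spherical monogenic of degree \<open>k\<close>. In polar coordinates the inner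
  product of two such functions is the product of a radial integral and of the integral of
  \<open>conj(Y) Y'\<close> over the sphere (\<open>L2_ball_inner_radial_times\<close>), and one of the two factors vanishes.

  If \<open>k \<noteq> k'\<close>, it is the spherical factor (\<open>monogenics_orthogonal\<close>): monogenics of
  different degrees are eigenfunctions, for different eigenvalues, of the spherical Dirac
  operator, which is symmetric. Symmetry is obtained by integrating a divergence over \<open>\<real>\<^sup>m\<close>
  against a radial cutoff, which a tangential derivative does not see. If \<open>k = k'\<close> but \<open>i \<noteq> i'\<close>,
  the spherical factor vanishes because the basis is orthonormal.

  If \<open>k = k'\<close>, \<open>i = i'\<close> and \<open>N \<noteq> N'\<close>, it is the radial factor. The operator maps \<open>F(|x|\<^sup>2) Y\<close> to a radial
  multiple of \<open>Y\<close> (\<open>cpswf_operator_radial_times\<close>), so the two profiles solve the same Sturm--Liouville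
  equation with eigenvalues \<open>\<mu>\<close> and \<open>\<nu>\<close>, and the Wronskian gives orthogonality when \<open>\<mu> \<noteq> \<nu>\<close>
  (\<open>even_cpswf_radial_orthogonal\<close>). That the eigenvalues do differ is forced by the enumeration: a double
  eigenvalue would produce uncountably many classes of eigenfunctions, more than a sequence can list
  (\<open>enumerated_eigenvalue_simple\<close>).

  Square integrability holds because the functions are bounded and, for \<open>\<alpha> > -1\<close>, the weight is integrable
  (\<open>radial_times_in_L2_ball\<close>).
\<close>

section \<open>Real bilinearity and Clifford vectors\<close>

lemma bounded_bilinear_cl_mult:
  "bounded_bilinear (cl_mult :: 'n::{finite,linorder} multivector \<Rightarrow> 'n multivector \<Rightarrow> 'n multivector)"
proof -
  have "bilinear (cl_mult :: 'n multivector \<Rightarrow> 'n multivector \<Rightarrow> 'n multivector)"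
    unfolding bilinear_def
    by (auto intro!: linearI
        simp: cl_mult_def vec_eq_iff algebra_simps sum.distrib scaleR_sum_right)
  then show ?thesis by (simp add: bilinear_conv_bounded_bilinear)
qed

interpretation cl: bounded_bilinear cl_mult
  by (rule bounded_bilinear_cl_mult)

lemma bounded_linear_cl_conj: "bounded_linear (cl_conj :: 'n::{finite,linorder} multivector \<Rightarrow> _)"
  by (auto intro!: linearI linear_conv_bounded_linear[THEN iffD1]
      simp: cl_conj_def vec_eq_iff algebra_simps)

lemmas cl_conj_scaleR = linear_scale[OF bounded_linear.linear[OF bounded_linear_cl_conj]]
lemmas cl_conj_minus = linear_neg[OF bounded_linear.linear[OF bounded_linear_cl_conj]]
lemmas cl_conj_zero = linear_0[OF bounded_linear.linear[OF bounded_linear_cl_conj]]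
lemmas cl_conj_sum = linear_sum[OF bounded_linear.linear[OF bounded_linear_cl_conj]]

definition cl_vector :: "'n point \<Rightarrow> 'n::{finite,linorder} multivector" where
  "cl_vector x = (\<Sum>j\<in>UNIV. (x $ j) *\<^sub>R cl_e j)"

text \<open>Only the \<open>j\<close>-th component of \<open>x\<close> survives in the anticommutator of \<open>e\<^sub>j\<close> and \<open>x\<close>, because distinct
  generators anticommute.\<close>

lemma cl_e_cl_vector: "cl_e j \<odot> cl_vector x = - (cl_vector x \<odot> cl_e j) - (2 * x $ j) *\<^sub>R cl_one"
proof -
  have "cl_e j \<odot> cl_vector x + cl_vector x \<odot> cl_e j
      = (\<Sum>i\<in>UNIV. (x $ i) *\<^sub>R (cl_e j \<odot> cl_e i + cl_e i \<odot> cl_e j))"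
    by (simp add: cl_vector_def cl.sum_left cl.sum_right cl.scaleR_left cl.scaleR_right
        scaleR_add_right sum.distrib)
  also have "\<dots> = (\<Sum>i\<in>{j}. (x $ i) *\<^sub>R (cl_e j \<odot> cl_e i + cl_e i \<odot> cl_e j))"
    by (rule sum.mono_neutral_right) (auto simp: cl_e_anticommute[of _ j])
  also have "\<dots> = - (2 * x $ j) *\<^sub>R cl_one"
    by (simp add: cl_e_square flip: scaleR_2)
  finally have "cl_e j \<odot> cl_vector x + cl_vector x \<odot> cl_e j = - (2 * x $ j) *\<^sub>R cl_one" .
  then have "cl_e j \<odot> cl_vector x = - (2 * x $ j) *\<^sub>R cl_one - cl_vector x \<odot> cl_e j"
    by (simp only: eq_diff_eq)
  then show ?thesis by simp
qed

lemma cl_vector_square: "cl_vector x \<odot> cl_vector x = - (norm x)\<^sup>2 *\<^sub>R cl_one"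
proof -
  have "2 *\<^sub>R (cl_vector x \<odot> cl_vector x) = cl_vector x \<odot> cl_vector x + cl_vector x \<odot> cl_vector x" by (simp add: scaleR_2)
  also have "\<dots> = (\<Sum>j\<in>UNIV. (x $ j) *\<^sub>R (cl_e j \<odot> cl_vector x)) + (\<Sum>j\<in>UNIV. (x $ j) *\<^sub>R (cl_vector x \<odot> cl_e j))"
    by (subst (1 4) cl_vector_def) (simp add: cl.sum_left cl.sum_right cl.scaleR_left cl.scaleR_right)
  also have "\<dots> = (\<Sum>j\<in>UNIV. (x $ j) *\<^sub>R (cl_e j \<odot> cl_vector x + cl_vector x \<odot> cl_e j))"
    by (simp add: scaleR_add_right sum.distrib)
  also have "\<dots> = 2 *\<^sub>R (- (norm x)\<^sup>2 *\<^sub>R cl_one)"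
    by (simp add: cl_e_cl_vector norm_eq_sqrt_inner inner_vec_def sum_nonneg sum_negf
        flip: scaleR_sum_left sum_distrib_left) (simp add: sum_distrib_left scaleR_sum_left mult_ac)
  finally show ?thesis by (rule real_vector.scale_left_imp_eq[rotated]) simp
qed

section \<open>Partial derivatives\<close>

text \<open>Derivatives along coordinate lines are all that the Dirac operator sees, so every differentiation
  below is a one-variable one. \<open>D j\<close> is the value at \<open>x\<close> of the \<open>j\<close>-th partial derivative.\<close>

definition partial_at :: "('n::finite point \<Rightarrow> 'b::real_normed_vector) \<Rightarrow> ('n \<Rightarrow> 'b) \<Rightarrow> 'n point \<Rightarrow> bool" where
  "partial_at f D x \<longleftrightarrow> (\<forall>j. ((\<lambda>t. f (x + t *\<^sub>R axis j 1)) has_vector_derivative D j) (at 0))"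

lemma dirac_eq: "partial_at f D x \<Longrightarrow> dirac f x = (\<Sum>j\<in>UNIV. cl_e j \<odot> D j)"
  unfolding partial_at_def dirac_def by (intro sum.cong refl arg_cong2[of _ _ _ _ cl_mult] vector_derivative_at) auto

lemma partial_at_cong_open:
  assumes "partial_at f D x" "open S" "x \<in> S" "\<And>y. y \<in> S \<Longrightarrow> f y = g y"
  shows "partial_at g D x"
  unfolding partial_at_def
proof
  fix j
  let ?T = "(\<lambda>t::real. x + t *\<^sub>R axis j 1) -` S"
  have "open ?T"
    by (rule open_vimage[OF assms(2)]) (intro continuous_intros)
  moreover have "0 \<in> ?T" using assms(3) by simp
  moreover have "((\<lambda>t. f (x + t *\<^sub>R axis j 1)) has_vector_derivative D j) (at 0)"
    using assms(1) unfolding partial_at_def by blast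
  ultimately show "((\<lambda>t. g (x + t *\<^sub>R axis j 1)) has_vector_derivative D j) (at 0)"
    using assms(4) by (auto intro: has_vector_derivative_transform_within_open)
qed

lemma partial_at_cl_mult:
  assumes "partial_at f D x" "partial_at g E x"
  shows "partial_at (\<lambda>y. f y \<odot> g y) (\<lambda>j. f x \<odot> E j + D j \<odot> g x) x"
  unfolding partial_at_def
proof
  fix j
  have "((\<lambda>t. f (x + t *\<^sub>R axis j 1)) has_vector_derivative D j) (at 0)"
       "((\<lambda>t. g (x + t *\<^sub>R axis j 1)) has_vector_derivative E j) (at 0)"
    using assms unfolding partial_at_def by blast+
  from cl.has_vector_derivative[OF this]
  show "((\<lambda>t. f (x + t *\<^sub>R axis j 1) \<odot> g (x + t *\<^sub>R axis j 1)) has_vector_derivative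
      f x \<odot> E j + D j \<odot> g x) (at 0)" by simp
qed

lemma partial_at_bounded_linear:
  assumes "bounded_linear h" "partial_at f D x"
  shows "partial_at (\<lambda>y. h (f y)) (\<lambda>j. h (D j)) x"
  using assms bounded_linear.has_vector_derivative unfolding partial_at_def by blast

lemma partial_at_const: "partial_at (\<lambda>_. a) (\<lambda>_. 0) x"
  unfolding partial_at_def by simp

lemma partial_at_cl_vector: "partial_at cl_vector cl_e x"
  unfolding partial_at_def
proof
  fix j
  have "cl_vector (x + t *\<^sub>R axis j 1) = cl_vector x + t *\<^sub>R cl_e j" for t
  proof -
    have "cl_vector (x + t *\<^sub>R axis j 1) = (\<Sum>i\<in>UNIV. (x $ i) *\<^sub>R cl_e i + (if i = j then t *\<^sub>R cl_e j else 0))"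
      unfolding cl_vector_def by (intro sum.cong) (auto simp: axis_def scaleR_add_left)
    then show ?thesis by (simp add: sum.distrib cl_vector_def)
  qed
  then show "((\<lambda>t. cl_vector (x + t *\<^sub>R axis j 1)) has_vector_derivative cl_e j) (at 0)"
    by (auto intro!: derivative_eq_intros)
qed

text \<open>The derivative of \<open>g\<close> is taken within a set \<open>S\<close> so that the lemma covers profiles that are smooth
  only on \<open>{0..1}\<close>. At the centre of the ball a one-sided derivative of \<open>g\<close> at \<open>0\<close> then suffices,
  since \<open>|y|\<^sup>2\<close> never leaves \<open>{0..1}\<close>.\<close>

lemma partial_at_radial:
  assumes g: "(g has_real_derivative g') (at ((norm x)\<^sup>2) within S)"
    and U: "open U" "x \<in> U" "(\<lambda>y. (norm y)\<^sup>2) ` U \<subseteq> S"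
    and u: "partial_at u D x"
  shows "partial_at (\<lambda>y. g ((norm y)\<^sup>2) *\<^sub>R u y)
     (\<lambda>j. (2 * x $ j * g') *\<^sub>R u x + g ((norm x)\<^sup>2) *\<^sub>R D j) x"
  unfolding partial_at_def
proof
  fix j
  let ?l = "\<lambda>t::real. x + t *\<^sub>R axis j 1"
  let ?q = "\<lambda>t. (norm (?l t))\<^sup>2"
  let ?T = "?l -` U"
  have T: "open ?T" "0 \<in> ?T"
    using U(2) by (auto intro!: open_vimage[OF U(1)] continuous_intros)
  have q: "?q t = (norm x)\<^sup>2 + 2 * t * x $ j + t\<^sup>2" for t
    unfolding power2_norm_eq_inner inner_add_left inner_add_right
    by (simp add: inner_axis inner_axis' inner_axis_axis power2_eq_square)
  have "(?q has_real_derivative 2 * x $ j) (at 0 within ?T)"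
    unfolding q by (auto intro!: derivative_eq_intros)
  moreover have "(g has_real_derivative g') (at (?q 0) within ?q ` ?T)"
  proof -
    have "?q ` ?T \<subseteq> S" using U(3) by blast
    from DERIV_subset[OF g this] show ?thesis by simp
  qed
  ultimately have "(g \<circ> ?q has_real_derivative g' * (2 * x $ j)) (at 0 within ?T)"
    by (rule DERIV_image_chain[rotated])
  then have d: "((\<lambda>t. g (?q t)) has_real_derivative g' * (2 * x $ j)) (at 0)"
    unfolding at_within_open[OF T(2,1)] o_def .
  have "((\<lambda>t. u (?l t)) has_vector_derivative D j) (at 0)"
    using u unfolding partial_at_def by blast
  from has_vector_derivative_scaleR[OF d this]
  show "((\<lambda>t. g (?q t) *\<^sub>R u (?l t)) has_vector_derivative
     (2 * x $ j * g') *\<^sub>R u x + g ((norm x)\<^sup>2) *\<^sub>R D j) (at 0)"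
    by (rule has_vector_derivative_eq_rhs) (simp add: add.commute mult.commute)
qed

lemma dirac_radial:
  assumes "(g has_real_derivative g') (at ((norm x)\<^sup>2) within S)"
    and "open U" "x \<in> U" "(\<lambda>y. (norm y)\<^sup>2) ` U \<subseteq> S"
    and "partial_at u D x"
  shows "dirac (\<lambda>y. g ((norm y)\<^sup>2) *\<^sub>R u y) x
    = (2 * g') *\<^sub>R (cl_vector x \<odot> u x) + g ((norm x)\<^sup>2) *\<^sub>R (\<Sum>j\<in>UNIV. cl_e j \<odot> D j)"
proof -
  have "cl_e j \<odot> ((2 * x $ j * g') *\<^sub>R u x + g ((norm x)\<^sup>2) *\<^sub>R D j)
     = (2 * g') *\<^sub>R (((x $ j) *\<^sub>R cl_e j) \<odot> u x) + g ((norm x)\<^sup>2) *\<^sub>R (cl_e j \<odot> D j)" for j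
    by (simp add: cl.add_right cl.scaleR_right cl.scaleR_left)
  then have "dirac (\<lambda>y. g ((norm y)\<^sup>2) *\<^sub>R u y) x
     = (\<Sum>j\<in>UNIV. (2 * g') *\<^sub>R (((x $ j) *\<^sub>R cl_e j) \<odot> u x) + g ((norm x)\<^sup>2) *\<^sub>R (cl_e j \<odot> D j))"
    using dirac_eq[OF partial_at_radial[OF assms]] by simp
  then show ?thesis
    by (simp add: cl_vector_def cl.sum_left sum.distrib scaleR_sum_right)
qed

section \<open>Homogeneous polynomials\<close>

lemma homogeneous_polynomial_scale:
  assumes "homogeneous_polynomial k Y"
  shows "Y (r *\<^sub>R x) = r ^ k *\<^sub>R Y x"
proof -
  obtain a where a: "\<And>x. Y x = (\<Sum>\<beta> | (\<Sum>j\<in>UNIV. \<beta> j) = k. (\<Prod>j\<in>UNIV. (x $ j) ^ \<beta> j) *\<^sub>R a \<beta>)"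
    using assms unfolding homogeneous_polynomial_def by blast
  have "(\<Prod>j\<in>UNIV. ((r *\<^sub>R x) $ j) ^ \<beta> j) = r ^ k * (\<Prod>j\<in>UNIV. (x $ j) ^ \<beta> j)"
    if "(\<Sum>j\<in>UNIV. \<beta> j) = k" for \<beta>
    unfolding that[symmetric] power_sum by (simp add: power_mult_distrib prod.distrib)
  then show ?thesis unfolding a scaleR_sum_right
    by (intro sum.cong) auto
qed

text \<open>The last property is Euler's identity for homogeneous functions; it holds monomial by monomial.\<close>

lemma homogeneous_polynomial_partials:
  assumes "homogeneous_polynomial k Y"
  obtains D where "\<And>x. partial_at Y (\<lambda>j. D j x) x" "\<And>j. continuous_on UNIV (D j)"
    "\<And>x. (\<Sum>j\<in>UNIV. (x $ j) *\<^sub>R D j x) = real k *\<^sub>R Y x"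
proof -
  let ?B = "{\<beta>::'a \<Rightarrow> nat. (\<Sum>j\<in>UNIV. \<beta> j) = k}"
  obtain a where a: "\<And>x. Y x = (\<Sum>\<beta>\<in>?B. (\<Prod>j\<in>UNIV. (x $ j) ^ \<beta> j) *\<^sub>R a \<beta>)"
    using assms unfolding homogeneous_polynomial_def by blast
  define D where "D j x = (\<Sum>\<beta>\<in>?B. (real (\<beta> j) * (x $ j) ^ (\<beta> j - 1)
      * (\<Prod>i\<in>UNIV-{j}. (x $ i) ^ \<beta> i)) *\<^sub>R a \<beta>)" for j x
  have split: "(\<Prod>i\<in>UNIV. h i) = h j * (\<Prod>i\<in>UNIV-{j}. h i)" for h :: "'a \<Rightarrow> real" and j
    by (simp add: prod.remove)
  have "partial_at Y (\<lambda>j. D j x) x" for x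
    unfolding partial_at_def
  proof
    fix j
    have line: "Y (x + t *\<^sub>R axis j 1) = (\<Sum>\<beta>\<in>?B. ((x $ j + t) ^ \<beta> j * (\<Prod>i\<in>UNIV-{j}. (x $ i) ^ \<beta> i)) *\<^sub>R a \<beta>)" for t
      unfolding a by (subst split[of _ j]) (auto intro!: sum.cong prod.cong simp: axis_def)
    show "((\<lambda>t. Y (x + t *\<^sub>R axis j 1)) has_vector_derivative D j x) (at 0)"
      unfolding line D_def
      by (rule has_vector_derivative_sum)
         (auto intro!: derivative_eq_intros simp: has_real_derivative_iff_has_vector_derivative[symmetric])
  qed
  moreover have "continuous_on UNIV (D j)" for j
    unfolding D_def by (intro continuous_intros)
  moreover have "(\<Sum>j\<in>UNIV. (x $ j) *\<^sub>R D j x) = real k *\<^sub>R Y x" for x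
  proof -
    have "(\<Sum>j\<in>UNIV. (x $ j) *\<^sub>R D j x)
      = (\<Sum>\<beta>\<in>?B. \<Sum>j\<in>UNIV. (x $ j * (real (\<beta> j) * (x $ j) ^ (\<beta> j - 1)
          * (\<Prod>i\<in>UNIV-{j}. (x $ i) ^ \<beta> i))) *\<^sub>R a \<beta>)"
      unfolding D_def scaleR_sum_right by (subst sum.swap) simp
    also have "\<dots> = (\<Sum>\<beta>\<in>?B. \<Sum>j\<in>UNIV. (real (\<beta> j) * (\<Prod>i\<in>UNIV. (x $ i) ^ \<beta> i)) *\<^sub>R a \<beta>)"
    proof (intro sum.cong refl arg_cong2[of _ _ _ _ scaleR])
      fix \<beta> :: "'a \<Rightarrow> nat" and j
      show "x $ j * (real (\<beta> j) * (x $ j) ^ (\<beta> j - 1) * (\<Prod>i\<in>UNIV-{j}. (x $ i) ^ \<beta> i))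
        = real (\<beta> j) * (\<Prod>i\<in>UNIV. (x $ i) ^ \<beta> i)"
        by (subst split[of _ j], cases "\<beta> j") auto
    qed
    also have "\<dots> = real k *\<^sub>R Y x"
    proof -
      have "(\<Sum>j\<in>UNIV. (real (\<beta> j) * p) *\<^sub>R a \<beta>) = real k *\<^sub>R (p *\<^sub>R a \<beta>)"
        if "(\<Sum>j\<in>UNIV. \<beta> j) = k" for \<beta> p
      proof -
        have "(\<Sum>j\<in>UNIV. (real (\<beta> j) * p) *\<^sub>R a \<beta>) = (\<Sum>j\<in>UNIV. real (\<beta> j)) *\<^sub>R (p *\<^sub>R a \<beta>)"
          unfolding scaleR_sum_left by (simp only: scaleR_scaleR)
        also have "(\<Sum>j\<in>UNIV. real (\<beta> j)) = real k"
          using that by (simp only: of_nat_sum[symmetric])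
        finally show ?thesis .
      qed
      then show ?thesis unfolding a scaleR_sum_right by (intro sum.cong) auto
    qed
    finally show ?thesis .
  qed
  ultimately show ?thesis using that by blast
qed

lemma continuous_on_homogeneous_polynomial:
  "homogeneous_polynomial k Y \<Longrightarrow> continuous_on S Y"
proof -
  assume "homogeneous_polynomial k Y"
  then obtain a where "Y = (\<lambda>x. \<Sum>\<beta> | (\<Sum>j\<in>UNIV. \<beta> j) = k. (\<Prod>j\<in>UNIV. (x $ j) ^ \<beta> j) *\<^sub>R a \<beta>)"
    unfolding homogeneous_polynomial_def by blast
  then show ?thesis by (auto intro!: continuous_intros)
qed

section \<open>Monogenics\<close>

lemma monogenic_partials:
  assumes "Y \<in> monogenics k"
  obtains D where "\<And>x. partial_at Y (\<lambda>j. D j x) x" "\<And>j. continuous_on UNIV (D j)"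
    "\<And>x. (\<Sum>j\<in>UNIV. (x $ j) *\<^sub>R D j x) = real k *\<^sub>R Y x"
    "\<And>x. (\<Sum>j\<in>UNIV. cl_e j \<odot> D j x) = 0"
proof -
  have Y: "homogeneous_polynomial k Y" "\<And>x. dirac Y x = 0"
    using assms unfolding monogenics_def by auto
  obtain D where D: "\<And>x. partial_at Y (\<lambda>j. D j x) x" "\<And>j. continuous_on UNIV (D j)"
    "\<And>x. (\<Sum>j\<in>UNIV. (x $ j) *\<^sub>R D j x) = real k *\<^sub>R Y x"
    using homogeneous_polynomial_partials[OF Y(1)] by blast
  show ?thesis
    using that[OF D] dirac_eq[OF D(1)] Y(2) by simp
qed

lemma sum_cl_e_square: "(\<Sum>j\<in>UNIV. cl_e j \<odot> cl_e j) = - real CARD('n) *\<^sub>R (cl_one :: 'n::{finite,linorder} multivector)"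
  unfolding cl_e_square sum_constant_scaleR by simp

text \<open>The left-hand side is \<open>\<partial>\<^sub>x(x Y)\<close>. Moving \<open>e\<^sub>j\<close> past \<open>x\<close> turns the part that differentiates \<open>Y\<close> into
  \<open>- x \<partial>\<^sub>xY\<close>, which vanishes, and into minus twice the Euler operator, which is \<open>k\<close>; differentiating
  \<open>x\<close> contributes \<open>-m\<close>.\<close>

lemma dirac_cl_vector_monogenic:
  fixes Y :: "'n point \<Rightarrow> 'n::{finite,linorder} multivector"
  assumes "(\<Sum>j\<in>UNIV. (x $ j) *\<^sub>R D j) = real k *\<^sub>R Y x" "(\<Sum>j\<in>UNIV. cl_e j \<odot> D j) = 0"
  shows "(\<Sum>j\<in>UNIV. cl_e j \<odot> (cl_vector x \<odot> D j + cl_e j \<odot> Y x)) = - real (CARD('n) + 2 * k) *\<^sub>R Y x"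
proof -
  have "cl_e j \<odot> (cl_vector x \<odot> D j + cl_e j \<odot> Y x)
      = (cl_e j \<odot> cl_e j) \<odot> Y x - cl_vector x \<odot> (cl_e j \<odot> D j) - 2 *\<^sub>R ((x $ j) *\<^sub>R D j)" for j
  proof -
    have "cl_e j \<odot> (cl_vector x \<odot> D j + cl_e j \<odot> Y x) = (cl_e j \<odot> cl_vector x) \<odot> D j + (cl_e j \<odot> cl_e j) \<odot> Y x"
      by (simp only: cl.add_right cl_mult_assoc)
    also have "(cl_e j \<odot> cl_vector x) \<odot> D j = - (cl_vector x \<odot> (cl_e j \<odot> D j)) - 2 *\<^sub>R ((x $ j) *\<^sub>R D j)"
      by (simp only: cl_e_cl_vector cl.diff_left cl.minus_left cl.scaleR_left cl_mult_one_left cl_mult_assoc scaleR_scaleR)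
    finally show ?thesis by simp
  qed
  then have "(\<Sum>j\<in>UNIV. cl_e j \<odot> (cl_vector x \<odot> D j + cl_e j \<odot> Y x))
     = (\<Sum>j\<in>UNIV. cl_e j \<odot> cl_e j) \<odot> Y x - cl_vector x \<odot> (\<Sum>j\<in>UNIV. cl_e j \<odot> D j) - 2 *\<^sub>R (\<Sum>j\<in>UNIV. (x $ j) *\<^sub>R D j)"
    by (simp only: sum_subtractf cl.sum_left cl.sum_right scaleR_sum_right)
  then show ?thesis
    unfolding assms sum_cl_e_square
    by (simp add: cl.scaleR_left cl.minus_left cl.zero_right cl_mult_one_left algebra_simps)
qed

section \<open>Polar coordinates\<close>

abbreviation ball_measure :: "('n::finite point) measure" where
  "ball_measure \<equiv> density lborel (indicator (ball 0 1))"

lemma sets_sphere_measure [simp, measurable_cong]: "sets sphere_measure = sets borel"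
  by (simp add: sphere_measure_def)

lemma emeasure_lborel_scaleR_image:
  fixes S :: "'a::euclidean_space set"
  assumes "S \<in> sets borel" "r > 0"
  shows "emeasure lborel ((*\<^sub>R) r ` S) = ennreal (r ^ DIM('a)) * emeasure lborel S"
proof -
  have S': "(*\<^sub>R) r ` S \<in> sets borel"
  proof -
    have "(*\<^sub>R) r ` S = (\<lambda>x. inverse r *\<^sub>R x) -` S \<inter> space borel"
      using assms(2) by (auto simp: image_iff intro!: bexI[of _ "inverse r *\<^sub>R _"])
    also have "\<dots> \<in> sets borel"
      using assms(1) by measurable
    finally show ?thesis .
  qed
  have "emeasure lborel ((*\<^sub>R) r ` S)
     = emeasure (density (distr lborel borel (\<lambda>x. 0 + r *\<^sub>R x)) (\<lambda>_. \<bar>r\<bar>^DIM('a))) ((*\<^sub>R) r ` S)"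
    using assms(2) by (subst lborel_affine[of r 0]) auto
  also have "\<dots> = ennreal (r ^ DIM('a)) * emeasure lborel ((\<lambda>x. r *\<^sub>R x) -` ((*\<^sub>R) r ` S))"
    using assms(2) S' by (simp add: emeasure_density nn_integral_cmult emeasure_distr)
  also have "(\<lambda>x. r *\<^sub>R x) -` ((*\<^sub>R) r ` S) = S"
    using assms(2) by auto
  finally show ?thesis .
qed

text \<open>The cone truncated at radius \<open>r\<close> is the dilate by \<open>r\<close> of the cone truncated at radius \<open>1\<close>.\<close>

lemma emeasure_cone:
  fixes B :: "('n::finite point) set"
  assumes B [measurable]: "B \<in> sets borel" and "0 < r" "r \<le> 1"
  shows "emeasure lborel {x\<in>ball 0 1. norm x < r \<and> sgn x \<in> B}
    = ennreal (r ^ CARD('n)) * emeasure lborel {x\<in>ball 0 1. sgn x \<in> B}"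
proof -
  have "{x\<in>ball 0 1. norm x < r \<and> sgn x \<in> B} = (*\<^sub>R) r ` {x\<in>ball 0 1. sgn x \<in> B}"
  proof (intro equalityI subsetI)
    fix x assume x: "x \<in> {x\<in>ball 0 1. norm x < r \<and> sgn x \<in> B}"
    then have "inverse r *\<^sub>R x \<in> {x\<in>ball 0 1. sgn x \<in> B}"
      using assms by (auto simp: sgn_scaleR field_simps)
    moreover have "x = r *\<^sub>R (inverse r *\<^sub>R x)" using assms by simp
    ultimately show "x \<in> (*\<^sub>R) r ` {x\<in>ball 0 1. sgn x \<in> B}" by blast
  next
    fix x assume "x \<in> (*\<^sub>R) r ` {x\<in>ball 0 1. sgn x \<in> B}"
    then obtain y where "x = r *\<^sub>R y" "norm y < 1" "sgn y \<in> B" by auto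
    moreover from this have "r * norm y < r" using assms(2) by simp
    moreover from this have "r * norm y < 1" using assms(3) by linarith
    ultimately show "x \<in> {x\<in>ball 0 1. norm x < r \<and> sgn x \<in> B}"
      using assms by (auto simp: sgn_scaleR)
  qed
  moreover have "{x\<in>ball 0 1. sgn x \<in> B} \<in> sets borel"
    by measurable
  ultimately show ?thesis
    using emeasure_lborel_scaleR_image[of "{x\<in>ball 0 1. sgn x \<in> B}" r] assms(2)
    by simp
qed

definition radial_measure :: "nat \<Rightarrow> real measure" where
  "radial_measure m = density lborel (\<lambda>r. ennreal (indicator {0<..<1} r * r ^ (m - 1)))"

lemma sets_radial_measure [simp, measurable_cong]: "sets (radial_measure m) = sets borel"
  by (simp add: radial_measure_def)

lemma emeasure_radial_measure_lessThan:
  assumes "0 < m" "0 < r" "r \<le> 1"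
  shows "emeasure (radial_measure m) {..<r} = ennreal (r ^ m / m)"
proof -
  have "emeasure (radial_measure m) {..<r}
     = (\<integral>\<^sup>+x. ennreal (indicator {0<..<1} x * x ^ (m - 1)) * indicator {..<r} x \<partial>lborel)"
    unfolding radial_measure_def by (subst emeasure_density) auto
  also have "\<dots> = (\<integral>\<^sup>+x. ennreal (x ^ (m - 1) * indicator {0..r} x) \<partial>lborel)"
  proof (rule nn_integral_cong_AE)
    have "AE x in lborel. x \<noteq> 0 \<and> x \<noteq> r"
      using AE_lborel_singleton[of "0::real"] AE_lborel_singleton[of r] by eventually_elim simp
    then show "AE x in lborel. ennreal (indicator {0<..<1} x * x ^ (m - 1)) * indicator {..<r} x
        = ennreal (x ^ (m - 1) * indicator {0..r} x)"
      by eventually_elim (use assms in \<open>auto simp: indicator_def\<close>)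
  qed
  also have "\<dots> = ennreal (r ^ m / m - 0 ^ m / m)"
  proof -
    have "((\<lambda>r. r ^ m / m) has_real_derivative x ^ (m - 1)) (at x)" for x :: real
      using assms(1) by (auto intro!: derivative_eq_intros)
    then have "(\<integral>\<^sup>+x. ennreal (x ^ (m - 1)) * indicator {0..r} x \<partial>lborel) = ennreal (r ^ m / m - 0 ^ m / m)"
      using assms by (intro nn_integral_FTC_Icc) (auto simp: has_real_derivative_iff_has_vector_derivative[symmetric] intro: DERIV_subset)
    moreover have "(\<integral>\<^sup>+x. ennreal (x ^ (m - 1) * indicator {0..r} x) \<partial>lborel) = (\<integral>\<^sup>+x. ennreal (x ^ (m - 1)) * indicator {0..r} x \<partial>lborel)"
      by (intro nn_integral_cong) (auto simp: indicator_def)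
    ultimately show ?thesis by simp
  qed
  finally show ?thesis using assms(1) by (simp add: zero_power)
qed

lemma emeasure_sphere_measure:
  fixes B :: "('n::finite point) set"
  assumes B [measurable]: "B \<in> sets borel"
  shows "emeasure sphere_measure B = ennreal (real CARD('n)) * emeasure lborel {x\<in>ball 0 1. sgn x \<in> B}"
proof -
  have [measurable]: "sgn -` B \<in> sets borel"
    using measurable_sets[OF borel_measurable_sgn B] by simp
  have "emeasure sphere_measure B = (\<integral>\<^sup>+x. ennreal (real CARD('n) * indicator (ball 0 1) x) * indicator (sgn -` B) x \<partial>lborel)"
    unfolding sphere_measure_def
    by (subst emeasure_distr, simp, simp, subst emeasure_density) (auto intro!: borel_measurable_times borel_measurable_indicator)
  also have "\<dots> = (\<integral>\<^sup>+x. ennreal (real CARD('n)) * indicator {x\<in>ball 0 1. sgn x \<in> B} x \<partial>lborel)"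
    by (intro nn_integral_cong) (auto simp: indicator_def)
  also have "\<dots> = ennreal (real CARD('n)) * emeasure lborel {x\<in>ball 0 1. sgn x \<in> B}"
    by (subst nn_integral_cmult) auto
  finally show ?thesis .
qed

lemma emeasure_ball_sgn_finite: "emeasure lborel {x\<in>ball (0 :: 'n::finite point) 1. sgn x \<in> B} < \<infinity>"
  by (rule le_less_trans[OF emeasure_mono emeasure_lborel_ball_finite[of 0 1]]) auto

lemma finite_measure_sphere_measure: "finite_measure (sphere_measure :: ('n::finite point) measure)"
proof
  have "space sphere_measure = (UNIV :: 'n point set)"
    by (simp add: sphere_measure_def)
  then show "emeasure sphere_measure (space sphere_measure :: 'n point set) \<noteq> \<infinity>"
    using emeasure_sphere_measure[of "UNIV :: 'n point set"] emeasure_ball_sgn_finite[of "UNIV :: 'n point set"]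
    by (auto simp: ennreal_mult_eq_top_iff)
qed

lemma finite_measure_radial_measure: "0 < m \<Longrightarrow> finite_measure (radial_measure m)"
proof
  assume "0 < m"
  have "emeasure (radial_measure m) (space (radial_measure m)) = emeasure (radial_measure m) {..<1}"
    unfolding radial_measure_def
    by (simp, subst (1 2) emeasure_density) (auto intro!: nn_integral_cong simp: indicator_def)
  then show "emeasure (radial_measure m) (space (radial_measure m)) \<noteq> \<infinity>"
    using emeasure_radial_measure_lessThan[OF \<open>0 < m\<close>, of 1] by simp
qed

text \<open>Lebesgue measure on the unit ball in polar coordinates \<open>(|x|, x/|x|)\<close> is the product of
  \<open>r\<^bsup>m-1\<^esup> dr\<close> and the surface measure. For a fixed set \<open>B\<close> of directions both sides are finite measures in the radial variable, so it is
  enough to compare them on the half-lines \<open>{..<r}\<close>, where the cone scaling applies.\<close>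

lemma distr_polar:
  "radial_measure CARD('n) \<Otimes>\<^sub>M sphere_measure
    = distr (ball_measure :: ('n::finite point) measure) (borel \<Otimes>\<^sub>M borel) (\<lambda>x. (norm x, sgn x))"
proof (rule pair_measure_eqI)
  show "sigma_finite_measure (radial_measure CARD('n))"
    by (intro finite_measure.axioms(1) finite_measure_radial_measure zero_less_card_finite)
  show "sigma_finite_measure (sphere_measure :: 'n point measure)"
    by (intro finite_measure.axioms(1)) (rule finite_measure_sphere_measure)
  show "sets (radial_measure CARD('n) \<Otimes>\<^sub>M (sphere_measure :: 'n point measure)) = sets (distr ball_measure (borel \<Otimes>\<^sub>M borel) (\<lambda>x. (norm x, sgn x)))"
    by (simp cong: sets_pair_measure_cong)
next
  fix A :: "real set" and B :: "'n point set"
  assume "A \<in> sets (radial_measure CARD('n))" "B \<in> sets sphere_measure"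
  then have A [measurable]: "A \<in> sets borel" and B [measurable]: "B \<in> sets borel" by auto
  let ?N = "distr (density lborel (indicator {x\<in>ball 0 1. sgn x \<in> B})) borel norm"
  let ?M = "scale_measure (emeasure sphere_measure B) (radial_measure CARD('n))"
  let ?c = "emeasure lborel {x\<in>ball 0 1. sgn x \<in> B}"
  have N: "emeasure ?N C = emeasure lborel {x\<in>ball 0 1. norm x \<in> C \<and> sgn x \<in> B}" if [measurable]: "C \<in> sets borel" for C
  proof -
    have [measurable]: "norm -` C \<in> sets (borel :: 'n point measure)"
      using measurable_sets[OF borel_measurable_norm that] by simp
    have "emeasure ?N C = (\<integral>\<^sup>+x. indicator {x\<in>ball 0 1. sgn x \<in> B} x * indicator (norm -` C) x \<partial>lborel)"
      by (subst emeasure_distr, simp, simp, subst emeasure_density) auto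
    also have "\<dots> = (\<integral>\<^sup>+x. indicator {x\<in>ball 0 1. norm x \<in> C \<and> sgn x \<in> B} x \<partial>lborel)"
      by (intro nn_integral_cong) (auto simp: indicator_def)
    finally show ?thesis by simp
  qed
  have le1: "emeasure ?M {..<r} = emeasure ?N {..<r}" if r: "0 < r" "r \<le> 1" for r
  proof -
    have "emeasure ?M {..<r} = ennreal (real CARD('n)) * ?c * ennreal (r ^ CARD('n) / CARD('n))"
      using r by (simp add: emeasure_radial_measure_lessThan emeasure_sphere_measure)
    also have "\<dots> = ennreal (r ^ CARD('n)) * ?c"
    proof -
      have "ennreal (real CARD('n)) * ennreal (r ^ CARD('n) / CARD('n)) = ennreal (r ^ CARD('n))"
        using r by (subst ennreal_mult[symmetric]) auto
      then show ?thesis by (simp only: mult.assoc[symmetric] mult.commute[of _ ?c])  (simp only: mult.assoc mult.commute[of _ ?c])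
    qed
    also have "\<dots> = emeasure ?N {..<r}"
      using emeasure_cone[OF B r] by (subst N) (simp_all add: lessThan_def)
    finally show ?thesis .
  qed
  have "?M = ?N"
  proof (rule measure_eqI_generator_eq[where E="range lessThan" and \<Omega>=UNIV and A="\<lambda>i. {..<real i}"])
    show "Int_stable (range (lessThan :: real \<Rightarrow> _))"
    proof (rule Int_stableI, elim rangeE)
      fix X Y :: "real set" and a b :: real assume "X = {..<a}" "Y = {..<b}"
      then have "X \<inter> Y = {..<min a b}" by auto
      then show "X \<inter> Y \<in> range lessThan" by blast
    qed
    show "sets ?M = sigma_sets UNIV (range lessThan)" "sets ?N = sigma_sets UNIV (range lessThan)"
      by (simp_all add: borel_Iio[where 'a=real])
    show "(\<Union>i. {..<real i}) = UNIV"
      by (auto simp: reals_Archimedean2)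
    fix X :: "real set" assume "X \<in> range lessThan"
    then obtain r where X: "X = {..<r}" by auto
    consider "r \<le> 0" | "0 < r" "r \<le> 1" | "1 < r" by linarith
    then show "emeasure ?M X = emeasure ?N X"
    proof cases
      case 1
      then have e: "{x \<in> ball (0::'n point) 1. norm x \<in> X \<and> sgn x \<in> B} = {}"
        unfolding X using norm_ge_zero[where 'a="'n point"] order_le_less_trans[of 0 "norm _" r] by force
      have "emeasure (radial_measure CARD('n)) X = 0"
        unfolding radial_measure_def X using 1
        by (subst emeasure_density) (auto simp: indicator_def nn_integral_0_iff_AE)
      then show ?thesis using N[of X] unfolding e by (simp add: X)
    next
      case 2 then show ?thesis unfolding X by (rule le1)
    next
      case 3
      have "emeasure (radial_measure CARD('n)) {..<r} = emeasure (radial_measure CARD('n)) {..<1}"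
        unfolding radial_measure_def using 3
        by (subst (1 2) emeasure_density) (auto intro!: nn_integral_cong simp: indicator_def)
      moreover have "{x\<in>ball (0::'n point) 1. norm x \<in> {..<r} \<and> sgn x \<in> B} = {x\<in>ball 0 1. norm x \<in> {..<1} \<and> sgn x \<in> B}"
        using 3 by auto
      ultimately show ?thesis using le1[of 1] N[of "{..<r}"] N[of "{..<1}"] by (simp add: X)
    qed
    next
    fix i
    show "emeasure ?M {..<real i} \<noteq> \<infinity>"
      using finite_measure.emeasure_finite[OF finite_measure_radial_measure[of "CARD('n)"], of "{..<real i}"]
        finite_measure.emeasure_finite[OF finite_measure_sphere_measure, of B]
      by (simp add: ennreal_mult_eq_top_iff)
  qed auto
  have "emeasure (radial_measure CARD('n)) A * emeasure sphere_measure B = emeasure ?M A"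
    by (simp add: mult.commute)
  also have "\<dots> = emeasure ?N A" by (simp only: \<open>?M = ?N\<close>)
  also have "\<dots> = emeasure lborel {x\<in>ball 0 1. norm x \<in> A \<and> sgn x \<in> B}" by (rule N) simp
  also have "\<dots> = (\<integral>\<^sup>+x. indicator {x\<in>ball 0 1. norm x \<in> A \<and> sgn x \<in> B} x \<partial>lborel)"
    by (rule nn_integral_indicator[symmetric]) simp
  also have "\<dots> = (\<integral>\<^sup>+x. indicator (ball 0 1) x * indicator ((\<lambda>x. (norm x, sgn x)) -` (A \<times> B)) x \<partial>lborel)"
    by (intro nn_integral_cong) (auto simp: indicator_def)
  also have "\<dots> = emeasure (distr ball_measure (borel \<Otimes>\<^sub>M borel) (\<lambda>x. (norm x, sgn x))) (A \<times> B)"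
  proof -
    have "norm -` A \<in> sets (borel :: 'n point measure)" "sgn -` B \<in> sets borel"
      using measurable_sets[OF borel_measurable_norm A] measurable_sets[OF borel_measurable_sgn B] by simp_all
    moreover have "(\<lambda>x. (norm x, sgn x)) -` (A \<times> B) = (norm -` A) \<inter> (sgn -` B)" by auto
    ultimately have "(\<lambda>x::'n point. (norm x, sgn x)) -` (A \<times> B) \<in> sets borel" by simp
    then show ?thesis
      by (subst emeasure_distr, simp, simp, subst emeasure_density)
         (auto intro!: borel_measurable_indicator)
  qed
  finally show "emeasure (radial_measure CARD('n)) A * emeasure sphere_measure B
    = emeasure (distr ball_measure (borel \<Otimes>\<^sub>M borel) (\<lambda>x. (norm x, sgn x))) (A \<times> B)" .
qed


text \<open>Integrals of functions of product form factor. This is the tool by which orthogonality on the ball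
  follows from the vanishing of either the radial or the spherical factor.\<close>

lemma integral_polar:
  fixes h :: "'n::finite point \<Rightarrow> 'b::{banach, second_countable_topology}" and \<phi> :: "real \<Rightarrow> real"
  assumes \<phi>: "set_integrable lborel {0<..<1} (\<lambda>r. r ^ (CARD('n) - 1) * \<phi> r)"
    and h: "integrable sphere_measure h"
  shows set_integrable_polar: "set_integrable lborel (ball 0 1) (\<lambda>x. \<phi> (norm x) *\<^sub>R h (sgn x))"
    and set_integral_polar: "(LINT x:ball 0 1|lborel. \<phi> (norm x) *\<^sub>R h (sgn x))
      = (LINT r:{0<..<1}|lborel. r ^ (CARD('n) - 1) * \<phi> r) *\<^sub>R (LINT \<omega>|sphere_measure. h \<omega>)"
proof -
  \<comment> \<open>The hypothesis says nothing about \<open>\<phi>\<close> outside \<open>(0,1)\<close>, so \<open>\<phi>\<close> itself need not be measurable.\<close>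
  define \<phi>' where "\<phi>' r = indicator {0<..<1} r * \<phi> r" for r
  let ?m = "CARD('n)"
  have \<phi>'_eq: "\<phi>' r = (indicator {0<..<1} r *\<^sub>R (r ^ (?m - 1) * \<phi> r)) / r ^ (?m - 1)" for r
    by (auto simp: \<phi>'_def indicator_def)
  have \<phi>'_meas [measurable]: "\<phi>' \<in> borel_measurable borel"
    unfolding \<phi>'_eq[abs_def]
    using \<phi> unfolding set_integrable_def by (intro borel_measurable_divide) auto
  have h_meas [measurable]: "h \<in> borel_measurable borel"
    using borel_measurable_integrable[OF h] by (simp cong: measurable_cong_sets)
  interpret R: finite_measure "radial_measure ?m"
    by (simp add: finite_measure_radial_measure)
  interpret S: finite_measure "sphere_measure :: 'n point measure"
    by (rule finite_measure_sphere_measure)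
  interpret pair_sigma_finite "radial_measure ?m" "sphere_measure :: 'n point measure" ..
  have nn: "0 \<le> indicator {0<..<1} r * r ^ (?m - 1)" for r :: real
    by (auto simp: indicator_def)
  have eq: "(indicator {0<..<1} r * r ^ (?m - 1)) *\<^sub>R \<phi>' r = indicator {0<..<1} r *\<^sub>R (r ^ (?m - 1) * \<phi> r)" for r
    by (auto simp: \<phi>'_def indicator_def)
  have R_int: "integrable (radial_measure ?m) \<phi>'"
    unfolding radial_measure_def
    by (subst integrable_density, simp, simp, use nn in simp)
       (use \<phi> in \<open>simp only: eq set_integrable_def\<close>)
  have R_eq: "(LINT r|radial_measure ?m. \<phi>' r) = (LINT r:{0<..<1}|lborel. r ^ (?m - 1) * \<phi> r)"
    unfolding radial_measure_def set_lebesgue_integral_def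
    by (subst integral_density, simp, simp, use nn in simp) (simp only: eq)
  let ?f = "\<lambda>(r, \<omega>). \<phi>' r *\<^sub>R h \<omega>"
  have f_meas [measurable]: "?f \<in> borel_measurable (borel \<Otimes>\<^sub>M borel)"
    by measurable
  have f_int: "integrable (radial_measure ?m \<Otimes>\<^sub>M sphere_measure) ?f"
  proof (rule Fubini_integrable)
    show "?f \<in> borel_measurable (radial_measure ?m \<Otimes>\<^sub>M sphere_measure)"
      by (simp cong: measurable_cong_sets)
    show "integrable (radial_measure ?m) (\<lambda>r. LINT \<omega>|sphere_measure. norm (case (r, \<omega>) of (r, \<omega>) \<Rightarrow> \<phi>' r *\<^sub>R h \<omega>))"
      using R_int by simp
    show "AE r in radial_measure ?m. integrable sphere_measure (\<lambda>\<omega>. case (r, \<omega>) of (r, \<omega>) \<Rightarrow> \<phi>' r *\<^sub>R h \<omega>)"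
      using h by simp
  qed
  have f_val: "integral\<^sup>L (radial_measure ?m \<Otimes>\<^sub>M sphere_measure) ?f
     = (LINT r:{0<..<1}|lborel. r ^ (?m - 1) * \<phi> r) *\<^sub>R (LINT \<omega>|sphere_measure. h \<omega>)"
    using integral_fst'[OF f_int] R_eq R_int by simp
  have meas: "(\<lambda>x. (norm x, sgn x)) \<in> (ball_measure :: 'n point measure) \<rightarrow>\<^sub>M borel \<Otimes>\<^sub>M borel"
    by simp
  have pt: "indicator (ball 0 1) x *\<^sub>R ?f (norm x, sgn x) = indicator (ball 0 1) x *\<^sub>R (\<phi> (norm x) *\<^sub>R h (sgn x))"
    if "x \<noteq> 0" for x :: "'n point"
    using that by (auto simp: \<phi>'_def indicator_def)
  have ae: "AE x in lborel. indicator (ball 0 1) x *\<^sub>R ?f (norm x, sgn x) = indicator (ball 0 1) x *\<^sub>R (\<phi> (norm x) *\<^sub>R h (sgn x :: 'n point))"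
    using AE_lborel_singleton[of 0] by eventually_elim (rule pt)
  have ind: "(indicator (ball 0 1) :: 'n point \<Rightarrow> ennreal) = (\<lambda>x. ennreal (indicator (ball 0 1) x))"
    by (auto simp: indicator_def)
  have ind_meas: "indicat_real (ball (0::'n point) 1) \<in> borel_measurable borel"
    by (intro borel_measurable_indicator) auto
  have int: "integrable lborel (\<lambda>x::'n point. indicator (ball 0 1) x *\<^sub>R ?f (norm x, sgn x))"
    using f_int unfolding distr_polar integrable_distr_eq[OF meas f_meas]
    unfolding ind by (subst (asm) integrable_density) (simp_all add: comp_def ind_meas)
  have val: "integral\<^sup>L (radial_measure ?m \<Otimes>\<^sub>M sphere_measure) ?f = (LINT x::'n point|lborel. indicator (ball 0 1) x *\<^sub>R ?f (norm x, sgn x))"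
    unfolding distr_polar integral_distr[OF meas f_meas]
    unfolding ind by (subst integral_density) (simp_all add: comp_def ind_meas)
  \<comment> \<open>Measurability of the integrand itself: it agrees with the measurable product form except at
    the origin, where \<open>norm x\<close> leaves the interval on which \<open>\<phi>\<close> is controlled.\<close>
  have ne: "(\<lambda>x::'n point. indicator (ball 0 1) x *\<^sub>R (\<phi> (norm x) *\<^sub>R h (sgn x)))
     = (\<lambda>x. if x = 0 then \<phi> 0 *\<^sub>R h 0 else indicator (ball 0 1) x *\<^sub>R ?f (norm x, sgn x))"
  proof
    fix x :: "'n point"
    show "indicator (ball 0 1) x *\<^sub>R (\<phi> (norm x) *\<^sub>R h (sgn x))
       = (if x = 0 then \<phi> 0 *\<^sub>R h 0 else indicator (ball 0 1) x *\<^sub>R ?f (norm x, sgn x))"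
      by (cases "x = 0", simp) (simp only: if_False pt not_False_eq_True simp_thms)
  qed
  have m2: "(\<lambda>x::'n point. indicator (ball 0 1) x *\<^sub>R (\<phi> (norm x) *\<^sub>R h (sgn x))) \<in> borel_measurable lborel"
    unfolding ne using borel_measurable_integrable[OF int] by (intro measurable_If) auto
  have m1: "(\<lambda>x::'n point. indicator (ball 0 1) x *\<^sub>R ?f (norm x, sgn x)) \<in> borel_measurable lborel"
    using borel_measurable_integrable[OF int] .
  show "set_integrable lborel (ball 0 1) (\<lambda>x. \<phi> (norm x) *\<^sub>R h (sgn x))"
    unfolding set_integrable_def using int integrable_cong_AE[OF m1 m2 ae] by blast
  show "(LINT x:ball 0 1|lborel. \<phi> (norm x) *\<^sub>R h (sgn x))
      = (LINT r:{0<..<1}|lborel. r ^ (CARD('n) - 1) * \<phi> r) *\<^sub>R (LINT \<omega>|sphere_measure. h \<omega>)"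
    using integral_cong_AE[OF m1 m2 ae] unfolding f_val[symmetric] val
    by (simp only: set_lebesgue_integral_def)
qed

lemma integrable_sphere_measure_continuous:
  fixes h :: "'n::finite point \<Rightarrow> 'b::euclidean_space"
  assumes "continuous_on UNIV h"
  shows "integrable sphere_measure h"
proof -
  interpret S: finite_measure "sphere_measure :: 'n point measure"
    by (rule finite_measure_sphere_measure)
  have "bounded (h ` cball 0 1)"
    by (intro compact_imp_bounded compact_continuous_image continuous_on_subset[OF assms]) auto
  then obtain K where "\<forall>x\<in>cball 0 1. norm (h x) \<le> K"
    unfolding bounded_iff by blast
  then have K: "norm (h x) \<le> K" if "norm x \<le> 1" for x
    using that by simp
  have hm: "h \<in> borel_measurable borel"
    by (rule borel_measurable_continuous_onI[OF assms])
  have "AE x in sphere_measure. norm (h x) \<le> K"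
  proof -
    have "norm (sgn x) \<le> 1" for x :: "'n point" by (simp add: norm_sgn)
    then show ?thesis
      unfolding sphere_measure_def using hm by (subst AE_distr_iff) (auto intro!: K)
  qed
  then show ?thesis
    using hm by (intro S.integrable_const_bound) (auto cong: measurable_cong_sets)
qed

section \<open>Orthogonality of monogenics of different degree\<close>

lemma integrable_continuous_vanishing:
  fixes h :: "'n::finite point \<Rightarrow> 'b::euclidean_space"
  assumes "continuous_on UNIV h" "\<And>x. norm x \<ge> 1 \<Longrightarrow> h x = 0"
  shows "integrable lborel h"
proof -
  have "integrable lborel (\<lambda>x. indicator (cball 0 1) x *\<^sub>R h x)"
    by (rule borel_integrable_compact) (auto intro: continuous_on_subset[OF assms(1)])
  also have "(\<lambda>x. indicator (cball 0 1) x *\<^sub>R h x) = h"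
    using assms(2) by (force simp: indicator_def fun_eq_iff)
  finally show ?thesis .
qed

text \<open>The integral of \<open>h(x + tv)\<close> does not depend on \<open>t\<close> by translation invariance. Its derivative in \<open>t\<close>
  is the integral of the directional derivative; dominated convergence applies because \<open>h\<close> is Lipschitz
  along the lines parallel to \<open>v\<close> and vanishes off the unit ball.\<close>

lemma integral_directional_derivative_eq_0:
  fixes h :: "'n::finite point \<Rightarrow> 'b::euclidean_space"
  assumes h: "continuous_on UNIV h" "\<And>x. norm x \<ge> 1 \<Longrightarrow> h x = 0"
    and h': "continuous_on UNIV h'" "\<And>x. norm x \<ge> 1 \<Longrightarrow> h' x = 0"
    and der: "\<And>x. ((\<lambda>t. h (x + t *\<^sub>R v)) has_vector_derivative h' x) (at 0)"
    and v: "norm v = 1"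
  shows "(LINT x|lborel. h' x) = 0"
proof -
  have "bounded (h' ` cball 0 1)"
    by (intro compact_imp_bounded compact_continuous_image continuous_on_subset[OF h'(1)]) auto
  then obtain L where "\<forall>x\<in>cball 0 1. norm (h' x) \<le> L"
    unfolding bounded_iff by blast
  then have L1: "norm (h' x) \<le> L" if "norm x \<le> 1" for x
    using that by simp
  have "0 \<le> L" using order_trans[OF norm_ge_zero L1[of 0]] by simp
  then have L: "norm (h' x) \<le> L" for x
    using L1[of x] h'(2)[of x] by (cases "norm x \<le> 1") auto
  have lip: "norm (h (x + t *\<^sub>R v) - h x) \<le> L * t" if "t \<ge> 0" for x t
  proof -
    have "((\<lambda>t. h (x + t *\<^sub>R v)) has_vector_derivative h' (x + s *\<^sub>R v)) (at s)" for s
    proof -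
      have "((\<lambda>t. h ((x + s *\<^sub>R v) + t *\<^sub>R v)) has_vector_derivative h' (x + s *\<^sub>R v)) (at (s - s))"
        using der[of "x + s *\<^sub>R v"] by simp
      moreover have "((\<lambda>t. t - s) has_vector_derivative 1) (at s)"
        by (auto intro!: derivative_eq_intros)
      ultimately show ?thesis
        using vector_diff_chain_at[of "\<lambda>t. t - s" 1 s "\<lambda>t. h ((x + s *\<^sub>R v) + t *\<^sub>R v)"]
        by (simp add: o_def algebra_simps)
    qed
    then have d: "((\<lambda>t. h (x + t *\<^sub>R v)) has_derivative (\<lambda>r. r *\<^sub>R h' (x + s *\<^sub>R v))) (at s within {0..t})" for s
      unfolding has_vector_derivative_def by (rule has_derivative_at_withinI)
    have "onorm (\<lambda>r. r *\<^sub>R h' (x + s *\<^sub>R v)) \<le> L" for s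
      by (rule onorm_le) (use L[of "x + s *\<^sub>R v"] in \<open>auto simp: mult.commute[of L] intro!: mult_left_mono\<close>)
    then have "norm (h (x + t *\<^sub>R v) - h (x + 0 *\<^sub>R v)) \<le> L * norm (t - 0)"
      using that by (intro differentiable_bound[OF _ d]) auto
    then show ?thesis using that by simp
  qed
  \<comment> \<open>Difference quotients with step \<open>1/(n+1)\<close>; each has integral zero.\<close>
  define s where "s n x = real (Suc n) *\<^sub>R (h (x + (1 / real (Suc n)) *\<^sub>R v) - h x)" for n x
  have int_h: "integrable lborel h"
    by (rule integrable_continuous_vanishing[OF h])
  have trans: "integrable lborel (\<lambda>x. h (x + c))" "(LINT x|lborel. h (x + c)) = (LINT x|lborel. h x)" for c
  proof -
    have *: "(+) c \<in> lborel \<rightarrow>\<^sub>M borel" by simp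
    have m: "h \<in> borel_measurable borel" using borel_measurable_integrable[OF int_h] by simp
    show "integrable lborel (\<lambda>x. h (x + c))"
      using int_h integrable_distr_eq[OF * m] lborel_distr_plus[of c] by (simp add: add.commute)
    show "(LINT x|lborel. h (x + c)) = (LINT x|lborel. h x)"
      using integral_distr[OF * m] lborel_distr_plus[of c] by (simp add: add.commute)
  qed
  have s0: "(LINT x|lborel. s n x) = 0" for n
    unfolding s_def using trans int_h by simp
  have "(\<lambda>n. LINT x|lborel. s n x) \<longlonglongrightarrow> (LINT x|lborel. h' x)"
  proof (rule integral_dominated_convergence[where w="\<lambda>x. L * indicator (ball 0 2) x"])
    show "h' \<in> borel_measurable lborel"
      using borel_measurable_continuous_onI[OF h'(1)] by simp
    show "s n \<in> borel_measurable lborel" for n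
      unfolding s_def[abs_def] using trans(1) int_h by (intro borel_measurable_integrable) simp
    show "integrable lborel (\<lambda>x::'n point. L * indicator (ball 0 2) x)"
      using emeasure_lborel_ball_finite[of "0::'n point" 2]
      by (intro integrable_mult_right integrable_real_indicator) auto
    show "AE x in lborel. (\<lambda>n. s n x) \<longlonglongrightarrow> h' x"
    proof (rule AE_I2)
      fix x
      have "((\<lambda>t. (1/t) *\<^sub>R (h (x + t *\<^sub>R v) - h x)) \<longlongrightarrow> h' x) (at 0)"
      proof (rule Lim_transform)
        have "((\<lambda>t. (h (x + t *\<^sub>R v) - h x - t *\<^sub>R h' x) /\<^sub>R norm t) \<longlongrightarrow> 0) (at 0)"
          using der[of x] unfolding has_vector_derivative_def has_derivative_at_within by simp
        then have "((\<lambda>t. norm ((h (x + t *\<^sub>R v) - h x - t *\<^sub>R h' x) /\<^sub>R norm t)) \<longlongrightarrow> 0) (at 0)"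
          by (rule tendsto_norm_zero)
        moreover have "norm ((h (x + t *\<^sub>R v) - h x - t *\<^sub>R h' x) /\<^sub>R norm t)
            = norm ((1/t) *\<^sub>R (h (x + t *\<^sub>R v) - h x) - h' x)" if "t \<noteq> 0" for t
        proof -
          have "(1/t) *\<^sub>R (h (x + t *\<^sub>R v) - h x) - h' x = (1/t) *\<^sub>R (h (x + t *\<^sub>R v) - h x - t *\<^sub>R h' x)"
            using that by (simp add: scaleR_diff_right)
          then show ?thesis by (simp add: divide_inverse)
        qed
        ultimately have "((\<lambda>t. norm ((1/t) *\<^sub>R (h (x + t *\<^sub>R v) - h x) - h' x)) \<longlongrightarrow> 0) (at 0)"
          by (subst (asm) Lim_cong_within[OF refl refl refl]) auto
        then show "((\<lambda>t. (1/t) *\<^sub>R (h (x + t *\<^sub>R v) - h x) - h' x) \<longlongrightarrow> 0) (at 0)"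
          by (rule tendsto_norm_zero_cancel)
        show "((\<lambda>t. h' x) \<longlongrightarrow> h' x) (at 0)" by simp
      qed
      moreover have "filterlim (\<lambda>n. 1 / real (Suc n)) (at 0) sequentially"
        by (intro filterlim_atI LIMSEQ_Suc[OF lim_1_over_n]) auto
      ultimately have "(\<lambda>n. (1/(1 / real (Suc n))) *\<^sub>R (h (x + (1 / real (Suc n)) *\<^sub>R v) - h x)) \<longlonglongrightarrow> h' x"
        by (rule filterlim_compose)
      then show "(\<lambda>n. s n x) \<longlonglongrightarrow> h' x" by (simp add: s_def)
    qed
    show "AE x in lborel. norm (s n x) \<le> L * indicator (ball 0 2) x" for n
    proof (rule AE_I2)
      fix x :: "'n point"
      show "norm (s n x) \<le> L * indicator (ball 0 2) x"
      proof (cases "norm x < 2")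
        case True
        have "norm (s n x) = real (Suc n) * norm (h (x + (1 / real (Suc n)) *\<^sub>R v) - h x)"
          unfolding s_def by simp
        also have "\<dots> \<le> real (Suc n) * (L * (1 / real (Suc n)))"
          by (intro mult_left_mono lip) auto
        also have "\<dots> = L" by simp
        finally show ?thesis using True by simp
      next
        case False
        have "norm ((1 / real (Suc n)) *\<^sub>R v) \<le> 1" using v by simp
        then have "1 \<le> norm (x + (1 / real (Suc n)) *\<^sub>R v)"
          using False norm_diff_ineq[of x "(1 / real (Suc n)) *\<^sub>R v"] by linarith
        then show ?thesis using False h(2) by (simp add: s_def)
      qed
    qed
  qed
  then show ?thesis unfolding s0 by (simp add: LIMSEQ_const_iff)
qed

text \<open>Up to a factor, the symbol of the spherical Dirac operator \<open>\<Gamma> = - x \<partial>\<^sub>x - E\<close>, where \<open>E\<close> is the Euler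
  operator: \<open>\<Sum>\<^sub>j gamma_field j x \<partial>\<^sub>j = 2 \<Gamma>\<close>, and monogenics of degree \<open>k\<close> satisfy \<open>\<Gamma> Y = - k Y\<close>. The
  commutator form shows that the field is tangential to spheres and free of divergence, so that integration by
  parts makes \<open>\<Gamma>\<close> symmetric even against a radial cutoff.\<close>

definition gamma_field :: "'n \<Rightarrow> 'n point \<Rightarrow> 'n::{finite,linorder} multivector" where
  "gamma_field j x = cl_e j \<odot> cl_vector x - cl_vector x \<odot> cl_e j"

lemma gamma_field_eq1: "gamma_field j x = 2 *\<^sub>R (cl_e j \<odot> cl_vector x) + (2 * x $ j) *\<^sub>R cl_one"
proof -
  have "cl_vector x \<odot> cl_e j = - (cl_e j \<odot> cl_vector x) - (2 * x $ j) *\<^sub>R cl_one"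
    by (simp add: cl_e_cl_vector)
  then show ?thesis by (simp add: gamma_field_def scaleR_2)
qed

lemma gamma_field_eq2: "gamma_field j x = - 2 *\<^sub>R (cl_vector x \<odot> cl_e j) - (2 * x $ j) *\<^sub>R cl_one"
  by (simp add: gamma_field_def cl_e_cl_vector scaleR_2)

lemma gamma_field_tangential: "(\<Sum>j\<in>UNIV. (x $ j) *\<^sub>R gamma_field j x) = 0"
proof -
  have "(\<Sum>j\<in>UNIV. (x $ j) *\<^sub>R gamma_field j x) = cl_vector x \<odot> cl_vector x - cl_vector x \<odot> cl_vector x"
    unfolding gamma_field_def scaleR_diff_right sum_subtractf
    by (subst (3 6) cl_vector_def) (simp only: cl.sum_left cl.sum_right cl.scaleR_left cl.scaleR_right)
  then show ?thesis by simp
qed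

lemma partial_at_gamma_field:
  "partial_at (gamma_field j) (\<lambda>i. cl_e j \<odot> cl_e i - cl_e i \<odot> cl_e j) x"
proof -
  have "partial_at (\<lambda>y. cl_e j \<odot> cl_vector y) (\<lambda>i. cl_e j \<odot> cl_e i + 0 \<odot> cl_vector x) x"
    by (rule partial_at_cl_mult[OF partial_at_const partial_at_cl_vector])
  moreover have "partial_at (\<lambda>y. cl_vector y \<odot> cl_e j) (\<lambda>i. cl_vector x \<odot> 0 + cl_e i \<odot> cl_e j) x"
    by (rule partial_at_cl_mult[OF partial_at_cl_vector partial_at_const])
  ultimately show ?thesis
    unfolding partial_at_def gamma_field_def cl.zero_left cl.zero_right add_0 add_0_right
    by (intro allI has_vector_derivative_diff) blast+
qed

text \<open>With \<open>D\<close> and \<open>E\<close> the partial derivatives of two monogenics at \<open>x\<close>, the field acts on the right factor as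
  \<open>- 2 l\<close> and on the left one as \<open>2 k\<close>: writing the commutator with \<open>e\<^sub>j\<close> last or with \<open>e\<^sub>j\<close> first exposes the Dirac
  operator, which annihilates, and leaves the Euler operator.\<close>

lemma gamma_identity:
  fixes x :: "'n::{finite,linorder} point" and y z :: "'n multivector"
  assumes D: "(\<Sum>j\<in>UNIV. (x $ j) *\<^sub>R D j) = real k *\<^sub>R y" "(\<Sum>j\<in>UNIV. cl_e j \<odot> D j) = 0"
    and E: "(\<Sum>j\<in>UNIV. (x $ j) *\<^sub>R E j) = real l *\<^sub>R z" "(\<Sum>j\<in>UNIV. cl_e j \<odot> E j) = 0"
  shows "(\<Sum>j\<in>UNIV. cl_conj y \<odot> (gamma_field j x \<odot> E j) + cl_conj (D j) \<odot> (gamma_field j x \<odot> z))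
     = (2 * (real k - real l)) *\<^sub>R (cl_conj y \<odot> z)"
proof -
  have 1: "(\<Sum>j\<in>UNIV. gamma_field j x \<odot> E j) = - (2 * real l) *\<^sub>R z"
  proof -
    have "gamma_field j x \<odot> E j = - 2 *\<^sub>R (cl_vector x \<odot> (cl_e j \<odot> E j)) - 2 *\<^sub>R ((x $ j) *\<^sub>R E j)" for j
      unfolding gamma_field_eq2
      by (simp only: cl.diff_left cl.minus_left cl.scaleR_left cl_mult_one_left cl_mult_assoc scaleR_scaleR)
    then have "(\<Sum>j\<in>UNIV. gamma_field j x \<odot> E j)
       = - 2 *\<^sub>R (cl_vector x \<odot> (\<Sum>j\<in>UNIV. cl_e j \<odot> E j)) - 2 *\<^sub>R (\<Sum>j\<in>UNIV. (x $ j) *\<^sub>R E j)"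
      by (simp only: sum_subtractf scaleR_sum_right[symmetric] cl.sum_right)
    then show ?thesis unfolding E by (simp add: cl.zero_right)
  qed
  have 2: "(\<Sum>j\<in>UNIV. cl_conj (D j) \<odot> gamma_field j x) = (2 * real k) *\<^sub>R cl_conj y"
  proof -
    have e: "cl_conj (D j) \<odot> cl_e j = cl_conj (- (cl_e j \<odot> D j))" for j
    proof -
      have "cl_conj (- (cl_e j \<odot> D j)) = cl_conj (D j) \<odot> cl_conj (- cl_e j)"
        by (simp only: cl_conj_mult[symmetric] cl.minus_left)
      also have "cl_conj (- cl_e j) = cl_e j"
        by (simp only: cl_conj_minus cl_conj_e minus_minus)
      finally show ?thesis by (rule sym)
    qed
    have "cl_conj (D j) \<odot> gamma_field j x
       = 2 *\<^sub>R (cl_conj (- (cl_e j \<odot> D j)) \<odot> cl_vector x) + 2 *\<^sub>R cl_conj ((x $ j) *\<^sub>R D j)" for j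
      unfolding gamma_field_eq1
      by (simp only: cl.add_right cl.scaleR_right cl_mult_assoc[symmetric] e cl_mult_one_right cl_conj_scaleR scaleR_scaleR)
    then have "(\<Sum>j\<in>UNIV. cl_conj (D j) \<odot> gamma_field j x)
       = 2 *\<^sub>R (cl_conj (- (\<Sum>j\<in>UNIV. cl_e j \<odot> D j)) \<odot> cl_vector x) + 2 *\<^sub>R cl_conj (\<Sum>j\<in>UNIV. (x $ j) *\<^sub>R D j)"
      by (simp only: sum.distrib scaleR_sum_right[symmetric] cl.sum_left[symmetric] cl_conj_sum[symmetric] sum_negf)
    then show ?thesis
      unfolding D by (simp add: cl_conj_scaleR cl_conj_zero cl.zero_left)
  qed
  have "(\<Sum>j\<in>UNIV. cl_conj y \<odot> (gamma_field j x \<odot> E j) + cl_conj (D j) \<odot> (gamma_field j x \<odot> z))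
     = cl_conj y \<odot> (\<Sum>j\<in>UNIV. gamma_field j x \<odot> E j) + (\<Sum>j\<in>UNIV. cl_conj (D j) \<odot> gamma_field j x) \<odot> z"
    by (simp only: sum.distrib cl.sum_left cl.sum_right cl_mult_assoc)
  then show ?thesis
    unfolding 1 2 cl.scaleR_left cl.scaleR_right scaleR_add_left[symmetric] by simp
qed

text \<open>A continuously differentiable profile that vanishes to second order on the unit sphere and is
  positive inside, so that \<open>cutoff (|x|\<^sup>2)\<close> times a polynomial can be integrated by parts on \<open>\<real>\<^sup>m\<close>.\<close>

definition cutoff :: "real \<Rightarrow> real" where
  "cutoff s = (max 0 (1 - s))\<^sup>2"

lemma cutoff_derivative: "(cutoff has_real_derivative - 2 * max 0 (1 - s)) (at s)"
proof -
  have "((\<lambda>u::real. (max 0 u)\<^sup>2) has_real_derivative 2 * max 0 u) (at u)" for u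
  proof -
    consider "u < 0" | "u > 0" | "u = 0" by linarith
    then show ?thesis
    proof cases
      case 1
      have "((\<lambda>_. 0) has_real_derivative 2 * max 0 u) (at u)" using 1 by simp
      then show ?thesis
        by (rule has_field_derivative_transform_within_open[where S="{..<0}"]) (use 1 in auto)
    next
      case 2
      have "((\<lambda>u. u\<^sup>2) has_real_derivative 2 * max 0 u) (at u)"
        using 2 by (auto intro!: derivative_eq_intros)
      then show ?thesis
        by (rule has_field_derivative_transform_within_open[where S="{0<..}"]) (use 2 in auto)
    next
      case 3
      have "((\<lambda>y::real. (max 0 y)\<^sup>2 / y) \<longlongrightarrow> 0) (at 0)"
      proof (rule Lim_null_comparison[where g="\<lambda>y. \<bar>y\<bar>"])
        show "\<forall>\<^sub>F y in at 0. norm ((max 0 y)\<^sup>2 / y) \<le> \<bar>y\<bar>"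
          by (rule always_eventually) (auto simp: max_def power2_eq_square)
        show "((\<lambda>y::real. \<bar>y\<bar>) \<longlongrightarrow> 0) (at 0)"
          by (auto intro!: tendsto_eq_intros)
      qed
      then show ?thesis using 3 by (simp add: has_field_derivative_iff)
    qed
  qed
  moreover have "((\<lambda>s. 1 - s) has_real_derivative - 1) (at s)"
    by (auto intro!: derivative_eq_intros)
  ultimately have "((\<lambda>s. (max 0 (1 - s))\<^sup>2) has_real_derivative (2 * max 0 (1 - s)) * - 1) (at s)"
    by (rule DERIV_chain2)
  then show ?thesis
    unfolding cutoff_def[abs_def] by simp
qed

lemma set_integral_pos:
  fixes f :: "real \<Rightarrow> real"
  assumes "continuous_on {0..1} f" "\<And>r. 0 < r \<Longrightarrow> r < 1 \<Longrightarrow> f r > 0"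
  shows "set_integrable lborel {0<..<1} f" "(LINT r:{0<..<1}|lborel. f r) > 0"
proof -
  have "set_integrable lborel {0..1} f"
    using assms(1) by (rule borel_integrable_atLeastAtMost')
  then show int: "set_integrable lborel {0<..<1} f"
    by (rule set_integrable_subset) auto
  have nn: "AE r in lborel. 0 \<le> indicator {0<..<1} r *\<^sub>R f r"
    using assms(2) by (auto simp: indicator_def less_imp_le)
  have "(LINT r:{0<..<1}|lborel. f r) \<noteq> 0"
  proof
    assume "(LINT r:{0<..<1}|lborel. f r) = 0"
    then have "AE r in lborel. indicator {0<..<1} r *\<^sub>R f r = 0"
      using integral_nonneg_eq_0_iff_AE[OF int[unfolded set_integrable_def] nn]
      by (simp add: set_lebesgue_integral_def)
    then have "AE r in lborel. r \<notin> {0<..<1::real}"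
      by eventually_elim (use assms(2) in \<open>force simp: indicator_def\<close>)
    then have "{0<..<1::real} \<in> null_sets lborel"
      by (subst AE_iff_null_sets) auto
    then show False
      using emeasure_lborel_Ioo[of 0 1] null_setsD1[of "{0<..<1::real}" lborel] by simp
  qed
  moreover have "(LINT r:{0<..<1}|lborel. f r) \<ge> 0"
    unfolding set_lebesgue_integral_def by (rule integral_nonneg_AE[OF nn])
  ultimately show "(LINT r:{0<..<1}|lborel. f r) > 0" by linarith
qed

lemma monogenic_product_polar:
  assumes "homogeneous_polynomial k Y" "homogeneous_polynomial l Z"
  shows "cl_conj (Y x) \<odot> Z x = norm x ^ (k + l) *\<^sub>R (cl_conj (Y (sgn x)) \<odot> Z (sgn x))"
proof -
  have "x = norm x *\<^sub>R sgn x" by (cases "x = 0") (simp_all add: sgn_div_norm)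
  then have "Y x = norm x ^ k *\<^sub>R Y (sgn x)" "Z x = norm x ^ l *\<^sub>R Z (sgn x)"
    using homogeneous_polynomial_scale[OF assms(1), of "norm x" "sgn x"]
      homogeneous_polynomial_scale[OF assms(2), of "norm x" "sgn x"] by simp_all
  then show ?thesis
    by (simp add: cl_conj_scaleR cl.scaleR_left cl.scaleR_right power_add)
qed

lemma continuous_on_cl_conj_mult:
  assumes "continuous_on S f" "continuous_on S g"
  shows "continuous_on S (\<lambda>x. cl_conj (f x) \<odot> g x)"
  by (intro cl.continuous_on bounded_linear.continuous_on[OF bounded_linear_cl_conj] assms)

text \<open>The spherical Dirac operator is symmetric and has \<open>Y\<close> and \<open>Z\<close> as eigenfunctions with different
  eigenvalues. Concretely, the divergence of \<open>w(|x|\<^sup>2) conj(Y) \<gamma>\<^sub>j Z\<close>, where \<open>\<gamma>\<close> is the tangential field, is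
  \<open>2 (k - l) w(|x|\<^sup>2) conj(Y) Z\<close>: the cutoff \<open>w\<close> is radial and is not differentiated by a tangential field. Its integral
  vanishes, and by polar coordinates that integral is a positive multiple of the one over the sphere.\<close>

lemma monogenics_orthogonal:
  fixes Y Z :: "'n point \<Rightarrow> 'n::{finite,linorder} multivector"
  assumes "Y \<in> monogenics k" "Z \<in> monogenics l" "k \<noteq> l"
  shows "(LINT \<omega>|sphere_measure. cl_conj (Y \<omega>) \<odot> Z \<omega>) = 0"
proof -
  obtain D where D: "\<And>x. partial_at Y (\<lambda>j. D j x) x" "\<And>j. continuous_on UNIV (D j)"
    "\<And>x. (\<Sum>j\<in>UNIV. (x $ j) *\<^sub>R D j x) = real k *\<^sub>R Y x" "\<And>x. (\<Sum>j\<in>UNIV. cl_e j \<odot> D j x) = 0"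
    using monogenic_partials[OF assms(1)] by blast
  obtain E where E: "\<And>x. partial_at Z (\<lambda>j. E j x) x" "\<And>j. continuous_on UNIV (E j)"
    "\<And>x. (\<Sum>j\<in>UNIV. (x $ j) *\<^sub>R E j x) = real l *\<^sub>R Z x" "\<And>x. (\<Sum>j\<in>UNIV. cl_e j \<odot> E j x) = 0"
    using monogenic_partials[OF assms(2)] by blast
  have hom: "homogeneous_polynomial k Y" "homogeneous_polynomial l Z"
    using assms(1,2) by (auto simp: monogenics_def)
  note cont = continuous_on_homogeneous_polynomial[OF hom(1)] continuous_on_homogeneous_polynomial[OF hom(2)]
  have cont_cl_vector: "continuous_on UNIV (cl_vector :: 'n point \<Rightarrow> _)"
    unfolding cl_vector_def by (intro continuous_intros)
  have cont_gamma: "continuous_on UNIV (gamma_field j)" for j :: 'n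
    unfolding gamma_field_def by (intro continuous_intros cl.continuous_on cont_cl_vector)
  have cont_cut: "continuous_on UNIV (\<lambda>x::'n point. cutoff ((norm x)\<^sup>2))"
    unfolding cutoff_def by (intro continuous_intros)
  \<comment> \<open>\<open>?w\<close> and \<open>?w'\<close> are the cutoff and the derivative of its profile; \<open>?U j\<close> is the \<open>j\<close>-th derivative
    of \<open>?u j\<close> (the field \<open>gamma_field j\<close> is constant in direction \<open>j\<close>) and \<open>?h' j\<close> that of \<open>?w ?u j\<close>.\<close>
  let ?w = "\<lambda>x. cutoff ((norm x)\<^sup>2)" and ?w' = "\<lambda>x. - 2 * max 0 (1 - (norm x)\<^sup>2)"
  let ?u = "\<lambda>j x. cl_conj (Y x) \<odot> (gamma_field j x \<odot> Z x)"
  let ?U = "\<lambda>j x. cl_conj (Y x) \<odot> (gamma_field j x \<odot> E j x) + cl_conj (D j x) \<odot> (gamma_field j x \<odot> Z x)"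
  let ?h' = "\<lambda>j x. (2 * x $ j * ?w' x) *\<^sub>R ?u j x + ?w x *\<^sub>R ?U j x"
  have zero: "?w x = 0" "?w' x = 0" if "norm x \<ge> 1" for x :: "'n point"
    using one_le_power[OF that, of 2] by (simp_all add: cutoff_def)
  have cont_u: "continuous_on UNIV (?u j)" "continuous_on UNIV (?U j)" for j
    by (intro continuous_on_add continuous_on_cl_conj_mult cl.continuous_on cont cont_gamma D(2) E(2))+
  have cont_h': "continuous_on UNIV (?h' j)" for j
    by (intro continuous_on_add continuous_on_scaleR cont_u cont_cut continuous_intros)
  have der: "partial_at (\<lambda>x. ?w x *\<^sub>R ?u j x) (\<lambda>i. (2 * x $ i * ?w' x) *\<^sub>R ?u j x + ?w x *\<^sub>R
      (cl_conj (Y x) \<odot> (gamma_field j x \<odot> E i x + (cl_e j \<odot> cl_e i - cl_e i \<odot> cl_e j) \<odot> Z x)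
        + cl_conj (D i x) \<odot> (gamma_field j x \<odot> Z x))) x" for j x
    by (rule partial_at_radial[where S=UNIV and U=UNIV])
       (intro cutoff_derivative partial_at_cl_mult partial_at_gamma_field D(1) E(1)
         partial_at_bounded_linear[OF bounded_linear_cl_conj] open_UNIV UNIV_I subset_UNIV)+
  have int0: "(LINT x|lborel. ?h' j x) = 0" for j
  proof (rule integral_directional_derivative_eq_0[where h="\<lambda>x. ?w x *\<^sub>R ?u j x" and v="axis j 1"])
    show "continuous_on UNIV (\<lambda>x. ?w x *\<^sub>R ?u j x)"
      by (intro continuous_on_scaleR cont_u cont_cut)
    show "continuous_on UNIV (?h' j)" by (rule cont_h')
    show "((\<lambda>t. ?w (x + t *\<^sub>R axis j 1) *\<^sub>R ?u j (x + t *\<^sub>R axis j 1)) has_vector_derivative ?h' j x) (at 0)" for x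
      using der[of j x] unfolding partial_at_def by (auto simp: cl.zero_left dest!: spec[of _ j])
    show "?w x *\<^sub>R ?u j x = 0" "?h' j x = 0" if "norm x \<ge> 1" for x
      using zero[OF that] by simp_all
    show "norm (axis j 1 :: 'n point) = 1" by simp
  qed
  have h'_int: "integrable lborel (?h' j)" for j
    by (rule integrable_continuous_vanishing[OF cont_h']) (use zero in simp)
  have sum_h': "(\<Sum>j\<in>UNIV. ?h' j x) = (2 * (real k - real l)) *\<^sub>R (?w x *\<^sub>R (cl_conj (Y x) \<odot> Z x))" for x
  proof -
    have "(\<Sum>j\<in>UNIV. (2 * x $ j * ?w' x) *\<^sub>R ?u j x)
       = (2 * ?w' x) *\<^sub>R (cl_conj (Y x) \<odot> ((\<Sum>j\<in>UNIV. (x $ j) *\<^sub>R gamma_field j x) \<odot> Z x))"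
      unfolding cl.sum_left cl.sum_right cl.scaleR_left cl.scaleR_right scaleR_sum_right
      by (intro sum.cong refl) simp
    also have "\<dots> = 0" by (simp add: gamma_field_tangential cl.zero_left cl.zero_right)
    finally have 1: "(\<Sum>j\<in>UNIV. (2 * x $ j * ?w' x) *\<^sub>R ?u j x) = 0" .
    have "(\<Sum>j\<in>UNIV. ?h' j x) = ?w x *\<^sub>R (\<Sum>j\<in>UNIV. ?U j x)"
      unfolding sum.distrib[of "\<lambda>j. (2 * x $ j * ?w' x) *\<^sub>R ?u j x"] 1 by (simp only: scaleR_sum_right add_0)
    then show ?thesis
      unfolding gamma_identity[OF D(3,4) E(3,4)] by simp
  qed
  have "0 = (\<Sum>j\<in>UNIV. (LINT x|lborel. ?h' j x))" by (simp only: int0 sum.neutral_const)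
  also have "\<dots> = (LINT x|lborel. (\<Sum>j\<in>UNIV. ?h' j x))"
    by (rule Bochner_Integration.integral_sum[symmetric]) (rule h'_int)
  also have "\<dots> = (2 * (real k - real l)) *\<^sub>R (LINT x|lborel. ?w x *\<^sub>R (cl_conj (Y x) \<odot> Z x))"
    unfolding sum_h' by (rule integral_scaleR_right)
  finally have "(LINT x|lborel. ?w x *\<^sub>R (cl_conj (Y x) \<odot> Z x)) = 0"
    using assms(3) by auto
  moreover have "(LINT x|lborel. ?w x *\<^sub>R (cl_conj (Y x) \<odot> Z x))
     = (LINT x:ball 0 1|lborel. (cutoff ((norm x)\<^sup>2) * norm x ^ (k + l)) *\<^sub>R (cl_conj (Y (sgn x)) \<odot> Z (sgn x)))"
    unfolding set_lebesgue_integral_def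
  proof (rule Bochner_Integration.integral_cong[OF refl])
    fix x :: "'n point"
    show "?w x *\<^sub>R (cl_conj (Y x) \<odot> Z x) = indicator (ball 0 1) x *\<^sub>R ((cutoff ((norm x)\<^sup>2) * norm x ^ (k + l)) *\<^sub>R (cl_conj (Y (sgn x)) \<odot> Z (sgn x)))"
      using zero(1)[of x] by (subst monogenic_product_polar[OF hom]) (auto simp: indicator_def)
  qed
  moreover have "\<dots> = (LINT r:{0<..<1}|lborel. r ^ (CARD('n) - 1) * (cutoff (r\<^sup>2) * r ^ (k + l))) *\<^sub>R (LINT \<omega>|sphere_measure. cl_conj (Y \<omega>) \<odot> Z \<omega>)"
    and "(LINT r:{0<..<1}|lborel. r ^ (CARD('n) - 1) * (cutoff (r\<^sup>2) * r ^ (k + l))) > 0"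
  proof -
    have c: "continuous_on {0..1::real} (\<lambda>r. r ^ (CARD('n) - 1) * (cutoff (r\<^sup>2) * r ^ (k + l)))"
      unfolding cutoff_def by (intro continuous_intros)
    have p: "r ^ (CARD('n) - 1) * (cutoff (r\<^sup>2) * r ^ (k + l)) > 0" if "0 < r" "r < 1" for r :: real
    proof -
      have "r\<^sup>2 < 1" using that by (simp add: abs_square_less_1)
      then show ?thesis using that by (simp add: cutoff_def)
    qed
    show "(LINT r:{0<..<1}|lborel. r ^ (CARD('n) - 1) * (cutoff (r\<^sup>2) * r ^ (k + l))) > 0"
      by (rule set_integral_pos(2)[OF c p])
    show "(LINT x:ball 0 1|lborel. (cutoff ((norm x)\<^sup>2) * norm x ^ (k + l)) *\<^sub>R (cl_conj (Y (sgn x)) \<odot> Z (sgn x)))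
      = (LINT r:{0<..<1}|lborel. r ^ (CARD('n) - 1) * (cutoff (r\<^sup>2) * r ^ (k + l))) *\<^sub>R (LINT \<omega>|sphere_measure. cl_conj (Y \<omega>) \<odot> Z \<omega>)"
      using set_integral_polar[OF set_integral_pos(1)[OF c p] integrable_sphere_measure_continuous[OF continuous_on_cl_conj_mult[OF cont]]]
      by simp
  qed
  ultimately show ?thesis by simp
qed

section \<open>The radial equation\<close>

lemma norm_power2_ball: "(\<lambda>y. (norm y)\<^sup>2) ` ball 0 1 \<subseteq> {0..1}"
  by (auto simp: power_le_one)

text \<open>Only the radial factor is differentiated, since \<open>Y\<close> is monogenic.\<close>

lemma dirac_radial_times_monogenic:
  assumes D: "partial_at Y D x" "(\<Sum>j\<in>UNIV. cl_e j \<odot> D j) = 0"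
    and F: "(F has_real_derivative F') (at ((norm x)\<^sup>2) within {0..1})"
    and x: "x \<in> ball 0 1"
  shows "dirac (radial_times F Y) x = (2 * F') *\<^sub>R (cl_vector x \<odot> Y x)"
  using dirac_radial[OF F open_ball x norm_power2_ball D(1)]
  unfolding D(2) radial_times_def[abs_def] by simp

text \<open>Applying the Dirac operator twice, first to \<open>F Y\<close> and then to a radial multiple of \<open>x Y\<close>, returns a
  radial multiple of \<open>Y\<close>. So the eigenvalue equation is an ordinary differential equation for \<open>F\<close> in
  \<open>t = |x|\<^sup>2\<close>. The formula is also needed at \<open>x = 0\<close>: it shows that linear combinations of admissible
  radial factors satisfy the eigenvalue equation on the whole ball.\<close>

lemma cpswf_operator_radial_times:
  fixes Y :: "'n point \<Rightarrow> 'n::{finite,linorder} multivector"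
  assumes Y: "Y \<in> monogenics k"
    and F: "\<forall>t\<in>{0..1}. (F has_real_derivative F1 t) (at t within {0..1})"
    and F1: "\<forall>t\<in>{0..1}. (F1 has_real_derivative F2 t) (at t within {0..1})"
    and x: "x \<in> ball 0 1" and t: "t = (norm x)\<^sup>2"
  shows "cpswf_operator c \<alpha> (radial_times F Y) x =
    (4 * pi\<^sup>2 * c\<^sup>2 * t * F t - (4 * t * (1 - t) * F2 t - 4 * (\<alpha> + 1) * t * F1 t
       + 2 * real (CARD('n) + 2 * k) * (1 - t) * F1 t)) *\<^sub>R Y x"
proof -
  obtain D where D0: "\<And>x. partial_at Y (\<lambda>j. D j x) x" "\<And>j. continuous_on UNIV (D j)"
    "\<And>x. (\<Sum>j\<in>UNIV. (x $ j) *\<^sub>R D j x) = real k *\<^sub>R Y x" "\<And>x. (\<Sum>j\<in>UNIV. cl_e j \<odot> D j x) = 0"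
    using monogenic_partials[OF Y] by blast
  note D = D0(1,3,4)
  have ball: "(norm y)\<^sup>2 \<in> {0..1}" if "y \<in> ball 0 1" for y :: "'n point"
    using that by (simp add: power_le_one)
  have t01: "0 \<le> t" "t < 1" "t \<in> {0..1}"
  proof -
    have "(norm x)\<^sup>2 < 1" using x by (simp add: abs_square_less_1)
    then show "0 \<le> t" "t < 1" "t \<in> {0..1}" by (simp_all add: t)
  qed
  \<comment> \<open>On the ball, the function to which the outer Dirac operator is applied is \<open>G (|y|\<^sup>2) y Y(y)\<close>.\<close>
  define G where "G t = (1 - t) powr (\<alpha> + 1) * (2 * F1 t)" for t
  define G' where "G' = (1 - t) powr (\<alpha> + 1) * (2 * F2 t) - (\<alpha> + 1) * (1 - t) powr \<alpha> * (2 * F1 t)"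
  have "((\<lambda>t. (1 - t) powr (\<alpha> + 1)) has_real_derivative - ((\<alpha> + 1) * (1 - t) powr \<alpha>)) (at t within {0..1})"
    using t01(2) by (auto intro!: derivative_eq_intros)
  from DERIV_mult[OF this DERIV_cmult[OF F1[rule_format, OF t01(3)], of 2]]
  have G: "(G has_real_derivative G') (at t within {0..1})"
    unfolding G_def[abs_def] G'_def by (rule DERIV_cong) simp
  have cl_vectorY: "partial_at (\<lambda>y. cl_vector y \<odot> Y y) (\<lambda>j. cl_vector x \<odot> D j x + cl_e j \<odot> Y x) x"
    by (rule partial_at_cl_mult[OF partial_at_cl_vector D(1)])
  have eq: "ball_weight (\<alpha> + 1) y *\<^sub>R dirac (radial_times F Y) y = G ((norm y)\<^sup>2) *\<^sub>R (cl_vector y \<odot> Y y)"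
    if "y \<in> ball 0 1" for y
    unfolding dirac_radial_times_monogenic[OF D(1,3) F[rule_format, OF ball[OF that]] that]
    by (simp only: ball_weight_def G_def scaleR_scaleR)
  note G2 = partial_at_radial[OF G[unfolded t] open_ball x norm_power2_ball cl_vectorY]
  have "dirac (\<lambda>y. ball_weight (\<alpha> + 1) y *\<^sub>R dirac (radial_times F Y) y) x
     = dirac (\<lambda>y. G ((norm y)\<^sup>2) *\<^sub>R (cl_vector y \<odot> Y y)) x"
    by (rule trans[OF dirac_eq[OF partial_at_cong_open[OF G2 open_ball x eq[symmetric]]] dirac_eq[OF G2, symmetric]])
  also have "\<dots> = (2 * G') *\<^sub>R (cl_vector x \<odot> (cl_vector x \<odot> Y x)) + G t *\<^sub>R (- real (CARD('n) + 2 * k) *\<^sub>R Y x)"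
    using dirac_radial[OF G[unfolded t] open_ball x norm_power2_ball cl_vectorY]
    unfolding dirac_cl_vector_monogenic[where Y=Y and x=x and D="\<lambda>j. D j x", OF D(2,3)] t .
  also have "cl_vector x \<odot> (cl_vector x \<odot> Y x) = - t *\<^sub>R Y x"
    unfolding cl_mult_assoc[symmetric] cl_vector_square
    by (simp only: cl.scaleR_left cl.minus_left cl_mult_one_left t)
  finally have "dirac (\<lambda>y. ball_weight (\<alpha> + 1) y *\<^sub>R dirac (radial_times F Y) y) x
     = (2 * G' * - t + G t * - real (CARD('n) + 2 * k)) *\<^sub>R Y x"
    by (simp only: scaleR_scaleR scaleR_add_left)
  moreover have "2 * G' * - t + G t * - real (CARD('n) + 2 * k) = - 2 * t * G' - real (CARD('n) + 2 * k) * G t"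
    by algebra
  ultimately have dd: "dirac (\<lambda>y. ball_weight (\<alpha> + 1) y *\<^sub>R dirac (radial_times F Y) y) x
     = (- 2 * t * G' - real (CARD('n) + 2 * k) * G t) *\<^sub>R Y x"
    by (simp only:)
  define u p q n where "u = (1 - t) powr (- \<alpha>)" and "p = (1 - t) powr \<alpha>"
    and "q = (1 - t) powr (\<alpha> + 1)" and "n = real (CARD('n) + 2 * k)"
  have w: "u * p = 1" "u * q = 1 - t"
    unfolding u_def p_def q_def powr_add[symmetric] using t01(2) by simp_all
  have GG: "G t = q * (2 * F1 t)" "G' = q * (2 * F2 t) - (\<alpha> + 1) * p * (2 * F1 t)"
    by (simp_all only: G_def G'_def p_def q_def)
  have "u * (- 2 * t * G' - n * G t)
     = - (4 * t * (u * q) * F2 t) + 4 * (\<alpha> + 1) * t * (u * p) * F1 t - 2 * n * (u * q) * F1 t"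
    unfolding GG by algebra
  then have *: "u * (- 2 * t * G' - n * G t) + 4 * pi\<^sup>2 * c\<^sup>2 * t * F t
     = 4 * pi\<^sup>2 * c\<^sup>2 * t * F t - (4 * t * (1 - t) * F2 t - 4 * (\<alpha> + 1) * t * F1 t + 2 * n * (1 - t) * F1 t)"
    unfolding w by simp
  have "cpswf_operator c \<alpha> (radial_times F Y) x
    = u *\<^sub>R ((- 2 * t * G' - n * G t) *\<^sub>R Y x) + (4 * pi\<^sup>2 * c\<^sup>2 * t) *\<^sub>R (F t *\<^sub>R Y x)"
    unfolding cpswf_operator_def dd by (simp only: ball_weight_def radial_times_def t u_def n_def)
  also have "\<dots> = (u * (- 2 * t * G' - n * G t) + 4 * pi\<^sup>2 * c\<^sup>2 * t * F t) *\<^sub>R Y x"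
    by (simp only: scaleR_scaleR scaleR_add_left)
  finally show ?thesis
    unfolding * unfolding n_def .
qed

lemma smooth_unit_interval_derivatives:
  assumes "smooth_unit_interval F"
  obtains F1 F2 where
    "\<forall>t\<in>{0..1}. (F has_real_derivative F1 t) (at t within {0..1})"
    "\<forall>t\<in>{0..1}. (F1 has_real_derivative F2 t) (at t within {0..1})"
proof -
  obtain D where D: "\<And>t. t \<in> {0..1} \<Longrightarrow> D 0 t = F t"
    "\<And>n t. t \<in> {0..1} \<Longrightarrow> (D n has_real_derivative D (Suc n) t) (at t within {0..1})"
    using assms unfolding smooth_unit_interval_def by blast
  have "(F has_real_derivative D 1 t) (at t within {0..1})" if "t \<in> {0..1}" for t
  proof (rule has_field_derivative_transform_within[OF _ zero_less_one that])
    show "(D 0 has_real_derivative D 1 t) (at t within {0..1})"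
      using D(2)[OF that, of 0] by simp
  qed (use D(1) in auto)
  then show ?thesis using that[of "D 1" "D 2"] D(2)[of _ 1] by (simp add: numeral_2_eq_2)
qed

lemma smooth_unit_interval_continuous: "smooth_unit_interval F \<Longrightarrow> continuous_on {0..1} F"
  by (erule smooth_unit_interval_derivatives) (blast intro: DERIV_continuous_on)

lemma smooth_unit_interval_combination:
  assumes "smooth_unit_interval F" "smooth_unit_interval G"
  shows "smooth_unit_interval (\<lambda>t. F t + s * G t)"
proof -
  obtain D where D: "\<And>t. t \<in> {0..1} \<Longrightarrow> D 0 t = F t"
    "\<And>n t. t \<in> {0..1} \<Longrightarrow> (D n has_real_derivative D (Suc n) t) (at t within {0..1})"
    using assms(1) unfolding smooth_unit_interval_def by blast
  obtain E where E: "\<And>t. t \<in> {0..1} \<Longrightarrow> E 0 t = G t"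
    "\<And>n t. t \<in> {0..1} \<Longrightarrow> (E n has_real_derivative E (Suc n) t) (at t within {0..1})"
    using assms(2) unfolding smooth_unit_interval_def by blast
  show ?thesis
    unfolding smooth_unit_interval_def
    by (rule exI[of _ "\<lambda>n t. D n t + s * E n t"])
       (auto intro!: derivative_eq_intros D(2) E(2) simp: D(1) E(1))
qed

text \<open>Supplies a ray on which \<open>Y\<close> vanishes at most at the origin. Along it the eigenvalue equation on the ball
  becomes an equation for the radial factor alone.\<close>

lemma homogeneous_nonzero_on_sphere:
  assumes "homogeneous_polynomial k Y" "Y x \<noteq> 0"
  obtains \<omega> where "norm \<omega> = 1" "Y \<omega> \<noteq> 0"
proof (cases "x = 0")
  case True
  fix j
  \<comment> \<open>If \<open>Y\<close> vanished at the unit vector, homogeneity with factor \<open>0\<close> would give \<open>Y 0 = 0\<close> for every \<open>k\<close>,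
    including \<open>k = 0\<close>, where \<open>0\<^sup>0 = 1\<close>.\<close>
  have "Y (0 *\<^sub>R axis j 1) = 0 ^ k *\<^sub>R Y (axis j 1)"
    by (rule homogeneous_polynomial_scale[OF assms(1)])
  then have "Y (axis j 1) \<noteq> 0" using assms(2) True by auto
  then show ?thesis using that[of "axis j 1"] by simp
next
  case False
  have "Y (norm x *\<^sub>R sgn x) = norm x ^ k *\<^sub>R Y (sgn x)"
    by (rule homogeneous_polynomial_scale[OF assms(1)])
  then have "Y (sgn x) \<noteq> 0" using assms(2) False by (auto simp: sgn_div_norm)
  then show ?thesis using that[of "sgn x"] False by (simp add: norm_sgn)
qed

lemma homogeneous_nonzero_at_radius:
  assumes "homogeneous_polynomial k Y" "Y y \<noteq> 0" "0 < t" "t < 1"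
  obtains x where "x \<in> ball 0 1" "(norm x)\<^sup>2 = t" "Y x \<noteq> 0"
proof -
  obtain \<omega> where w: "norm \<omega> = 1" "Y \<omega> \<noteq> 0"
    using homogeneous_nonzero_on_sphere[OF assms(1,2)] by blast
  have "Y (sqrt t *\<^sub>R \<omega>) \<noteq> 0"
    unfolding homogeneous_polynomial_scale[OF assms(1)] using w assms by simp
  moreover have "(norm (sqrt t *\<^sub>R \<omega>))\<^sup>2 = t" "sqrt t *\<^sub>R \<omega> \<in> ball 0 1"
    using w assms by simp_all
  ultimately show ?thesis using that by blast
qed

lemma even_cpswf_radial_nonzero:
  assumes "even_cpswf_radial c \<alpha> Y \<mu> F" obtains y where "Y y \<noteq> 0"
  using assms unfolding even_cpswf_radial_def cpswf_eigenfunction_def radial_times_def by fastforce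

lemma even_cpswf_radial_ode:
  fixes Y :: "'n point \<Rightarrow> 'n::{finite,linorder} multivector"
  assumes F: "even_cpswf_radial c \<alpha> Y \<mu> F" and Y: "Y \<in> monogenics k"
    and F1: "\<forall>t\<in>{0..1}. (F has_real_derivative F1 t) (at t within {0..1})"
    and F2: "\<forall>t\<in>{0..1}. (F1 has_real_derivative F2 t) (at t within {0..1})"
    and t: "0 < t" "t < 1"
  shows "4 * t * (1 - t) * F2 t - 4 * (\<alpha> + 1) * t * F1 t + 2 * real (CARD('n) + 2 * k) * (1 - t) * F1 t
    = (4 * pi\<^sup>2 * c\<^sup>2 * t - \<mu>) * F t"
proof -
  have hom: "homogeneous_polynomial k Y" using Y by (simp add: monogenics_def)
  obtain y where "Y y \<noteq> 0" using even_cpswf_radial_nonzero[OF F] .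
  then obtain x where x: "x \<in> ball 0 1" "(norm x)\<^sup>2 = t" "Y x \<noteq> 0"
    using homogeneous_nonzero_at_radius[OF hom _ t] by blast
  have "cpswf_operator c \<alpha> (radial_times F Y) x = \<mu> *\<^sub>R (F t *\<^sub>R Y x)"
    using F x unfolding even_cpswf_radial_def cpswf_eigenfunction_def radial_times_def by simp
  then have "4 * pi\<^sup>2 * c\<^sup>2 * t * F t - (4 * t * (1 - t) * F2 t - 4 * (\<alpha> + 1) * t * F1 t
       + 2 * real (CARD('n) + 2 * k) * (1 - t) * F1 t) = \<mu> * F t"
    using x(3) unfolding cpswf_operator_radial_times[OF Y F1 F2 x(1) x(2)[symmetric]] scaleR_scaleR
    by (simp only: scaleR_cancel_right simp_thms)
  then show ?thesis unfolding left_diff_distrib by linarith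
qed

lemma even_cpswf_radial_combination:
  fixes Y :: "'n point \<Rightarrow> 'n::{finite,linorder} multivector"
  assumes F: "even_cpswf_radial c \<alpha> Y \<mu> F" and G: "even_cpswf_radial c \<alpha> Y \<mu> G"
    and Y: "Y \<in> monogenics k" and ne: "\<exists>t\<in>{0..1}. F t + s * G t \<noteq> 0"
  shows "even_cpswf_radial c \<alpha> Y \<mu> (\<lambda>t. F t + s * G t)"
proof -
  let ?H = "\<lambda>t. F t + s * G t"
  have hom: "homogeneous_polynomial k Y" using Y by (simp add: monogenics_def)
  have smooth: "smooth_unit_interval F" "smooth_unit_interval G"
    using F G unfolding even_cpswf_radial_def by auto
  obtain F1 F2 where F12: "\<forall>t\<in>{0..1}. (F has_real_derivative F1 t) (at t within {0..1})"
    "\<forall>t\<in>{0..1}. (F1 has_real_derivative F2 t) (at t within {0..1})"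
    using smooth_unit_interval_derivatives[OF smooth(1)] by blast
  obtain G1 G2 where G12: "\<forall>t\<in>{0..1}. (G has_real_derivative G1 t) (at t within {0..1})"
    "\<forall>t\<in>{0..1}. (G1 has_real_derivative G2 t) (at t within {0..1})"
    using smooth_unit_interval_derivatives[OF smooth(2)] by blast
  note H = smooth_unit_interval_combination[OF smooth, of s]
  have H1: "\<forall>t\<in>{0..1}. (?H has_real_derivative F1 t + s * G1 t) (at t within {0..1})"
    using F12(1) G12(1) by (auto intro!: derivative_eq_intros)
  have H2: "\<forall>t\<in>{0..1}. ((\<lambda>t. F1 t + s * G1 t) has_real_derivative F2 t + s * G2 t) (at t within {0..1})"
    using F12(2) G12(2) by (auto intro!: derivative_eq_intros)
  have eig: "cpswf_operator c \<alpha> (radial_times ?H Y) x = \<mu> *\<^sub>R radial_times ?H Y x" if x: "x \<in> ball 0 1" for x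
  proof -
    have "cpswf_operator c \<alpha> (radial_times ?H Y) x
      = cpswf_operator c \<alpha> (radial_times F Y) x + s *\<^sub>R cpswf_operator c \<alpha> (radial_times G Y) x"
      unfolding cpswf_operator_radial_times[OF Y H1 H2 x refl] cpswf_operator_radial_times[OF Y F12 x refl]
        cpswf_operator_radial_times[OF Y G12 x refl] scaleR_scaleR scaleR_add_left[symmetric]
      by (rule arg_cong2[of _ _ _ _ scaleR]) (simp_all add: algebra_simps)
    also have "\<dots> = \<mu> *\<^sub>R radial_times F Y x + s *\<^sub>R (\<mu> *\<^sub>R radial_times G Y x)"
      using F G x unfolding even_cpswf_radial_def cpswf_eigenfunction_def by simp
    also have "\<dots> = \<mu> *\<^sub>R radial_times ?H Y x"
      by (simp add: radial_times_def algebra_simps)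
    finally show ?thesis .
  qed
  \<comment> \<open>An eigenfunction must be nonzero inside the open ball, so a radial factor that is nonzero
    at an end point of \<open>{0..1}\<close> only would not do; continuity excludes this.\<close>
  have "\<exists>t. 0 < t \<and> t < 1 \<and> ?H t \<noteq> 0"
  proof (rule ccontr)
    assume "\<not> ?thesis"
    then have z: "?H t = 0" if "t \<in> {0<..<1}" for t using that by auto
    have "?H t = 0" if "t \<in> {0..1}" for t
      by (rule continuous_constant_on_closure[where S="{0<..<1}" and f="?H"])
         (use smooth_unit_interval_continuous[OF H] z that in auto)
    then show False using ne by blast
  qed
  then obtain t where t: "0 < t" "t < 1" "?H t \<noteq> 0" by blast
  obtain y where "Y y \<noteq> 0" using even_cpswf_radial_nonzero[OF F] .
  then obtain x where "x \<in> ball 0 1" "(norm x)\<^sup>2 = t" "Y x \<noteq> 0"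
    using homogeneous_nonzero_at_radius[OF hom _ t(1,2)] by blast
  then have "\<exists>x\<in>ball 0 1. radial_times ?H Y x \<noteq> 0"
    using t(3) by (auto simp: radial_times_def)
  then show ?thesis
    using H ne eig unfolding even_cpswf_radial_def cpswf_eigenfunction_def by blast
qed

section \<open>Simplicity of the eigenvalues\<close>

text \<open>If two different members of the list shared an eigenvalue, the combinations \<open>P N + s P N'\<close> for real
  \<open>s\<close> would be admissible and pairwise non-proportional. A list contains only countably many classes, so it could not
  contain all of them.\<close>

lemma enumerated_eigenvalue_simple:
  fixes Y :: "'n point \<Rightarrow> 'n::{finite,linorder} multivector"
  assumes enum: "even_cpswf_enumeration c \<alpha> Y P" and Y: "Y \<in> monogenics k"
    and N: "even_cpswf_radial c \<alpha> Y \<mu> (P N)" and N': "even_cpswf_radial c \<alpha> Y \<mu> (P N')"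
  shows "N = N'"
proof (rule ccontr)
  assume "N \<noteq> N'"
  have uniq: "\<exists>!n. \<exists>a. a \<noteq> 0 \<and> (\<forall>t\<in>{0..1}. F t = a * P n t)" if "even_cpswf_radial c \<alpha> Y \<mu> F" for F
    using enum that unfolding even_cpswf_enumeration_def by blast
  have nz: "\<exists>t\<in>{0..1}. P N t \<noteq> 0" "\<exists>t\<in>{0..1}. P N' t \<noteq> 0"
    using N N' unfolding even_cpswf_radial_def by blast+
  have indep: "p = 0 \<and> q = 0" if eq: "\<And>t. t \<in> {0..1} \<Longrightarrow> p * P N t = q * P N' t" for p q
  proof -
    have "p = 0"
    proof (rule ccontr)
      assume p: "p \<noteq> 0"
      then have e: "P N t = (q / p) * P N' t" if "t \<in> {0..1}" for t
        using eq[OF that] by (simp add: field_simps)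
      then have "q / p \<noteq> 0" using nz(1) by fastforce
      then have "\<exists>a. a \<noteq> 0 \<and> (\<forall>t\<in>{0..1}. P N t = a * P N' t)" using e by blast
      moreover have "\<exists>a. a \<noteq> 0 \<and> (\<forall>t\<in>{0..1}. P N t = a * P N t)" by (rule exI[of _ 1]) simp
      ultimately show False using uniq[OF N] \<open>N \<noteq> N'\<close> by blast
    qed
    moreover from this have "q = 0" using eq nz(2) by fastforce
    ultimately show ?thesis by blast
  qed
  have "\<exists>n a. a \<noteq> 0 \<and> (\<forall>t\<in>{0..1}. P N t + s * P N' t = a * P n t)" for s
  proof -
    have "\<exists>t\<in>{0..1}. P N t + s * P N' t \<noteq> 0"
    proof (rule ccontr)
      assume "\<not> ?thesis"
      then have "1 * P N t = (- s) * P N' t" if "t \<in> {0..1}" for t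
        using that by (simp add: eq_neg_iff_add_eq_0)
      from indep[OF this] show False by simp
    qed
    from uniq[OF even_cpswf_radial_combination[OF N N' Y this]] show ?thesis by blast
  qed
  then obtain n a where na: "\<And>s. a s \<noteq> 0" "\<And>s t. t \<in> {0..1} \<Longrightarrow> P N t + s * P N' t = a s * P (n s) t"
    by metis
  have "\<not> inj (n :: real \<Rightarrow> nat)"
    using countableI[of n UNIV] uncountable_UNIV_real by blast
  then obtain s s' where s: "s \<noteq> s'" "n s = n s'" unfolding inj_def by blast
  have "(a s' - a s) * P N t = (a s * s' - a s' * s) * P N' t" if t: "t \<in> {0..1}" for t
  proof -
    have "a s' * (P N t + s * P N' t) = a s * (P N t + s' * P N' t)"
      unfolding na(2)[OF t] s(2) by simp
    then show ?thesis by (simp add: algebra_simps)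
  qed
  from indep[OF this] have "a s' = a s" "a s * s' = a s' * s" by auto
  then show False using s(1) na(1)[of s] by simp
qed

section \<open>Radial integrals\<close>

text \<open>The integrand has the explicit antiderivative \<open>- (1 - r\<^sup>2)\<^bsup>\<alpha>+1\<^esup> / (2 (\<alpha> + 1))\<close>, which stays bounded at
  \<open>r = 1\<close> exactly because \<open>\<alpha> > -1\<close>.\<close>

lemma set_integrable_radial_weight:
  fixes \<alpha> :: real
  assumes "\<alpha> > -1"
  shows "set_integrable lborel {0<..<1} (\<lambda>r. r * (1 - r\<^sup>2) powr \<alpha>)"
proof -
  let ?F = "\<lambda>r. - ((1 - r\<^sup>2) powr (\<alpha> + 1)) / (2 * (\<alpha> + 1))"
  have sq: "r\<^sup>2 < 1" if "0 < r" "r < 1" for r :: real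
    using that by (simp add: abs_square_less_1)
  have lim: "(?F \<longlongrightarrow> - (1 / (2 * (\<alpha> + 1)))) (at_right 0)" "(?F \<longlongrightarrow> 0) (at_left 1)"
    using assms by (auto intro!: tendsto_eq_intros eventually_at_leftI[of 0 1] simp: sq less_imp_le)
  have "set_integrable lborel (einterval (ereal 0) (ereal 1)) (\<lambda>r. r * (1 - r\<^sup>2) powr \<alpha>)"
  proof (rule interval_integral_FTC_nonneg(1)[where F="?F" and A="- (1 / (2 * (\<alpha> + 1)))" and B=0])
    fix r :: real assume "ereal 0 < ereal r" "ereal r < ereal 1"
    then have r: "0 < r" "r < 1" by auto
    have "((\<lambda>r. (1 - r\<^sup>2) powr (\<alpha> + 1)) has_real_derivative - ((\<alpha> + 1) * (1 - r\<^sup>2) powr \<alpha> * (2 * r))) (at r)"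
      using sq[OF r] by (auto intro!: derivative_eq_intros)
    from DERIV_cdivide[OF DERIV_minus[OF this], of "2 * (\<alpha> + 1)"]
    show "(?F has_real_derivative r * (1 - r\<^sup>2) powr \<alpha>) (at r)"
      by (rule DERIV_cong) (use assms in \<open>simp add: field_simps\<close>)
    show "isCont (\<lambda>r. r * (1 - r\<^sup>2) powr \<alpha>) r"
      using sq[OF r] by (intro continuous_intros) auto
  qed (use lim in \<open>auto simp: ereal_tendsto_simps\<close>)
  then show ?thesis by simp
qed

lemma continuous_on_radial_weight: "continuous_on {0<..<1} (\<lambda>r::real. (1 - r\<^sup>2) powr \<alpha>)"
proof -
  have "r\<^sup>2 < 1" if "0 < r" "r < 1" for r :: real
    using that by (simp add: abs_square_less_1)
  then show ?thesis by (auto intro!: continuous_intros simp: less_imp_neq[symmetric])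
qed

text \<open>The condition \<open>m \<ge> 2\<close> provides the factor \<open>r\<close> of the preceding lemma.\<close>

lemma set_integrable_radial_weight_mult:
  fixes \<alpha> :: real and K :: "real \<Rightarrow> real"
  assumes \<alpha>: "\<alpha> > -1" and m: "m \<ge> 2" and K: "continuous_on {0..1} K"
  shows "set_integrable lborel {0<..<1} (\<lambda>r. r ^ (m - 1) * ((1 - r\<^sup>2) powr \<alpha> * K r))"
proof -
  have "bounded (K ` {0..1})"
    by (intro compact_imp_bounded compact_continuous_image K compact_Icc)
  then obtain B where B: "\<And>r. r \<in> {0..1} \<Longrightarrow> \<bar>K r\<bar> \<le> B"
    unfolding bounded_iff by (auto simp del: atLeastAtMost_iff)
  have B0: "0 \<le> B" using order_trans[OF abs_ge_zero B[of 0]] by simp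
  have mr: "m - 1 = Suc (m - 2)" using m by simp
  show ?thesis
  proof (rule set_integrable_bound[where f="\<lambda>r. B * (r * (1 - r\<^sup>2) powr \<alpha>)"])
    show "set_integrable lborel {0<..<1} (\<lambda>r. B * (r * (1 - r\<^sup>2) powr \<alpha>))"
      using set_integrable_radial_weight[OF \<alpha>] by simp
    have cont: "continuous_on {0<..<1} (\<lambda>r. r ^ (m - 1) * ((1 - r\<^sup>2) powr \<alpha> * K r))"
      by (intro continuous_on_mult continuous_on_radial_weight continuous_on_subset[OF K] continuous_intros) auto
    show "set_borel_measurable lborel {0<..<1} (\<lambda>r. r ^ (m - 1) * ((1 - r\<^sup>2) powr \<alpha> * K r))"
      using borel_measurable_continuous_on_indicator[OF _ cont]
      by (simp add: set_borel_measurable_def)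
    show "AE r in lborel. r \<in> {0<..<1} \<longrightarrow>
        norm (r ^ (m - 1) * ((1 - r\<^sup>2) powr \<alpha> * K r)) \<le> norm (B * (r * (1 - r\<^sup>2) powr \<alpha>))"
    proof (intro AE_I2 impI)
      fix r :: real assume r: "r \<in> {0<..<1}"
      have "r ^ (m - 2) * \<bar>K r\<bar> \<le> 1 * B"
        using r by (intro mult_mono B power_le_one) auto
      then have "(r ^ (m - 2) * \<bar>K r\<bar>) * (r * (1 - r\<^sup>2) powr \<alpha>) \<le> B * (r * (1 - r\<^sup>2) powr \<alpha>)"
        using r by (intro mult_right_mono) auto
      then show "norm (r ^ (m - 1) * ((1 - r\<^sup>2) powr \<alpha> * K r)) \<le> norm (B * (r * (1 - r\<^sup>2) powr \<alpha>))"
        using r B0 unfolding mr by (simp add: abs_mult mult_ac power_Suc)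
    qed
  qed
qed

lemma continuous_on_comp_power2:
  fixes F :: "real \<Rightarrow> real"
  assumes "continuous_on {0..1} F" shows "continuous_on {0..1} (\<lambda>r. F (r\<^sup>2))"
  by (rule continuous_on_compose2[OF assms]) (auto intro!: continuous_intros simp: power_le_one)

text \<open>The radial equation is of Sturm--Liouville form. In the variable \<open>r = sqrt t\<close> the weighted Wronskian
  \<open>W(r) = r\<^bsup>m+2k\<^esup> (1 - r\<^sup>2)\<^bsup>\<alpha>+1\<^esup> (F' G - G' F)(r\<^sup>2)\<close> has derivative \<open>(\<nu> - \<mu>)/2\<close> times the integrand, and it
  vanishes at both ends since \<open>m + 2k > 0\<close> and \<open>\<alpha> + 1 > 0\<close>.\<close>

lemma even_cpswf_radial_orthogonal:
  fixes Y :: "'n point \<Rightarrow> 'n::{finite,linorder} multivector"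
  assumes m: "CARD('n) \<ge> 2" and \<alpha>: "\<alpha> > -1"
    and F: "even_cpswf_radial c \<alpha> Y \<mu> F" and G: "even_cpswf_radial c \<alpha> Y \<nu> G"
    and Y: "Y \<in> monogenics k" and "\<mu> \<noteq> \<nu>"
  shows "(LINT r:{0<..<1}|lborel. r ^ (CARD('n) - 1) * ((1 - r\<^sup>2) powr \<alpha> * (F (r\<^sup>2) * G (r\<^sup>2) * r ^ (k + k)))) = 0"
proof -
  have smooth: "smooth_unit_interval F" "smooth_unit_interval G"
    using F G unfolding even_cpswf_radial_def by auto
  obtain F1 F2 where F12: "\<forall>t\<in>{0..1}. (F has_real_derivative F1 t) (at t within {0..1})"
    "\<forall>t\<in>{0..1}. (F1 has_real_derivative F2 t) (at t within {0..1})"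
    using smooth_unit_interval_derivatives[OF smooth(1)] by blast
  obtain G1 G2 where G12: "\<forall>t\<in>{0..1}. (G has_real_derivative G1 t) (at t within {0..1})"
    "\<forall>t\<in>{0..1}. (G1 has_real_derivative G2 t) (at t within {0..1})"
    using smooth_unit_interval_derivatives[OF smooth(2)] by blast
  have cont: "continuous_on {0..1} F" "continuous_on {0..1} G" "continuous_on {0..1} F1" "continuous_on {0..1} G1"
    using F12 G12 by (blast intro: DERIV_continuous_on)+
  have sq: "0 < r\<^sup>2" "r\<^sup>2 < 1" if "0 < r" "r < 1" for r :: real
    using that by (simp_all add: abs_square_less_1)
  define n where "n = CARD('n) + 2 * k"
  have n: "n = Suc (n - 1)" "n - 1 = (CARD('n) - 1) + (k + k)" "n \<noteq> 0" using m by (simp_all add: n_def)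
  define f where "f r = r ^ (CARD('n) - 1) * ((1 - r\<^sup>2) powr \<alpha> * (F (r\<^sup>2) * G (r\<^sup>2) * r ^ (k + k)))" for r
  define V where "V r = F1 (r\<^sup>2) * G (r\<^sup>2) - G1 (r\<^sup>2) * F (r\<^sup>2)" for r
  define W where "W r = r ^ n * (1 - r\<^sup>2) powr (\<alpha> + 1) * V r" for r
  have contV: "continuous_on {0..1} V"
    unfolding V_def by (intro continuous_intros continuous_on_comp_power2 cont)
  have f_int: "set_integrable lborel {0<..<1} f"
    unfolding f_def
    by (intro set_integrable_radial_weight_mult \<alpha> m continuous_intros continuous_on_comp_power2 cont)
  have W_der: "(W has_real_derivative ((\<nu> - \<mu>) / 2) * f r) (at r)" if r: "0 < r" "r < 1" for r
  proof -
    let ?t = "r\<^sup>2"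
    have at: "at ?t within {0..1} = at ?t"
      using sq[OF r] by (intro at_within_interior) auto
    have t: "?t \<in> {0..1}" using sq[OF r] by auto
    have sqd: "((\<lambda>r. r\<^sup>2) has_real_derivative 2 * r) (at r)"
      by (auto intro!: derivative_eq_intros)
    note d = F12(1)[rule_format, OF t, unfolded at] F12(2)[rule_format, OF t, unfolded at]
      G12(1)[rule_format, OF t, unfolded at] G12(2)[rule_format, OF t, unfolded at]
    have dsq: "((\<lambda>r. h (r\<^sup>2)) has_real_derivative h' * (2 * r)) (at r)"
      if "(h has_real_derivative h') (at ?t)" for h h'
      using DERIV_chain2[where g="\<lambda>r. r\<^sup>2", OF that sqd] .
    have dV: "(V has_real_derivative 2 * r * (F2 ?t * G ?t - G2 ?t * F ?t)) (at r)"
      unfolding V_def[abs_def]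
      by (rule DERIV_cong[OF DERIV_diff[OF DERIV_mult[OF dsq[OF d(2)] dsq[OF d(3)]] DERIV_mult[OF dsq[OF d(4)] dsq[OF d(1)]]]])
         (simp add: algebra_simps)
    have dw: "((\<lambda>r. (1 - r\<^sup>2) powr (\<alpha> + 1)) has_real_derivative - ((\<alpha> + 1) * (1 - r\<^sup>2) powr \<alpha> * (2 * r))) (at r)"
      using sq[OF r] by (auto intro!: derivative_eq_intros)
    have dp: "((\<lambda>r. r ^ n) has_real_derivative real n * r ^ (n - 1)) (at r)"
      by (auto intro!: derivative_eq_intros)
    have p1: "(1 - r\<^sup>2) powr (\<alpha> + 1) = (1 - r\<^sup>2) powr \<alpha> * (1 - r\<^sup>2)"
      using sq[OF r] by (simp add: powr_add)
    have p2: "r ^ n = r ^ (n - 1) * r" by (subst n(1)) simp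
    have ode: "4 * ?t * (1 - ?t) * F2 ?t - 4 * (\<alpha> + 1) * ?t * F1 ?t + 2 * real n * (1 - ?t) * F1 ?t
        = (4 * pi\<^sup>2 * c\<^sup>2 * ?t - \<mu>) * F ?t"
      "4 * ?t * (1 - ?t) * G2 ?t - 4 * (\<alpha> + 1) * ?t * G1 ?t + 2 * real n * (1 - ?t) * G1 ?t
        = (4 * pi\<^sup>2 * c\<^sup>2 * ?t - \<nu>) * G ?t"
      unfolding n_def
      by (rule even_cpswf_radial_ode[OF F Y F12 sq[OF r]] even_cpswf_radial_ode[OF G Y G12 sq[OF r]])+
    \<comment> \<open>The left-hand side is the product rule for \<open>W\<close>; on the right the two radial equations appear,
      cross-multiplied by \<open>G\<close> and \<open>F\<close>, and their terms in \<open>c\<close> cancel.\<close>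
    have "(real n * r ^ (n - 1) * (1 - ?t) powr (\<alpha> + 1) - (\<alpha> + 1) * (1 - ?t) powr \<alpha> * (2 * r) * r ^ n) * V r
        + 2 * r * (F2 ?t * G ?t - G2 ?t * F ?t) * (r ^ n * (1 - ?t) powr (\<alpha> + 1))
      = r ^ (n - 1) * (1 - ?t) powr \<alpha> / 2 *
         ((4 * ?t * (1 - ?t) * F2 ?t - 4 * (\<alpha> + 1) * ?t * F1 ?t + 2 * real n * (1 - ?t) * F1 ?t) * G ?t
         - (4 * ?t * (1 - ?t) * G2 ?t - 4 * (\<alpha> + 1) * ?t * G1 ?t + 2 * real n * (1 - ?t) * G1 ?t) * F ?t)"
      unfolding p1 p2 V_def by (simp add: field_simps power2_eq_square)
    also have "\<dots> = ((\<nu> - \<mu>) / 2) * f r"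
      unfolding ode f_def n(2) power_add by (simp add: field_simps)
    finally have alg: "(real n * r ^ (n - 1) * (1 - ?t) powr (\<alpha> + 1) - (\<alpha> + 1) * (1 - ?t) powr \<alpha> * (2 * r) * r ^ n) * V r
        + 2 * r * (F2 ?t * G ?t - G2 ?t * F ?t) * (r ^ n * (1 - ?t) powr (\<alpha> + 1)) = ((\<nu> - \<mu>) / 2) * f r" .
    show ?thesis
      unfolding W_def[abs_def] alg[symmetric]
      by (rule DERIV_cong[OF DERIV_mult[OF DERIV_mult[OF dp dw] dV]]) (simp add: algebra_simps)
  qed
  have contW: "continuous_on {0..1} W"
    unfolding W_def
    by (intro continuous_on_mult contV continuous_on_powr' continuous_intros)
       (use \<alpha> in \<open>auto simp: power_le_one\<close>)
  have "(LBINT r=ereal 0..ereal 1. ((\<nu> - \<mu>) / 2) * f r) = 0 - 0"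
  proof (rule interval_integral_FTC_integrable[where F=W])
    show "(W has_vector_derivative ((\<nu> - \<mu>) / 2) * f r) (at r)" if "ereal 0 < ereal r" "ereal r < ereal 1" for r
      using W_der[of r] that by (simp add: has_real_derivative_iff_has_vector_derivative)
    have "continuous_on {0<..<1} f"
      unfolding f_def
      by (intro continuous_on_mult continuous_on_radial_weight continuous_intros
          continuous_on_subset[OF continuous_on_comp_power2[OF cont(1)]]
          continuous_on_subset[OF continuous_on_comp_power2[OF cont(2)]]) auto
    then show "isCont (\<lambda>r. ((\<nu> - \<mu>) / 2) * f r) r" if "ereal 0 < ereal r" "ereal r < ereal 1" for r
      using that by (intro continuous_intros) (simp add: continuous_on_eq_continuous_at)
    show "set_integrable lborel (einterval (ereal 0) (ereal 1)) (\<lambda>r. ((\<nu> - \<mu>) / 2) * f r)"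
      using f_int by simp
    have "(W \<longlongrightarrow> W 0) (at 0 within {0..1})" "(W \<longlongrightarrow> W 1) (at 1 within {0..1})"
      using contW unfolding continuous_on_def by auto
    moreover have "W 0 = 0" "W 1 = 0"
      using n(3) \<alpha> by (simp_all add: W_def)
    ultimately show "((W \<circ> real_of_ereal) \<longlongrightarrow> 0) (at_right (ereal 0))"
      "((W \<circ> real_of_ereal) \<longlongrightarrow> 0) (at_left (ereal 1))"
      by (simp_all add: ereal_tendsto_simps at_within_Icc_at_right at_within_Icc_at_left)
  qed simp
  then have "((\<nu> - \<mu>) / 2) * (LINT r:{0<..<1}|lborel. f r) = 0"
    by (simp add: interval_lebesgue_integral_def)
  then show ?thesis using \<open>\<mu> \<noteq> \<nu>\<close> unfolding f_def by simp
qed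

section \<open>Orthogonality on the ball\<close>

lemma L2_ball_inner_radial_times:
  fixes Y Z :: "'n point \<Rightarrow> 'n::{finite,linorder} multivector"
  assumes m: "CARD('n) \<ge> 2" and \<alpha>: "\<alpha> > -1"
    and F: "continuous_on {0..1} F" and G: "continuous_on {0..1} G"
    and Y: "homogeneous_polynomial k Y" and Z: "homogeneous_polynomial l Z"
  shows "L2_ball_inner \<alpha> (radial_times F Y) (radial_times G Z)
    = (LINT r:{0<..<1}|lborel. r ^ (CARD('n) - 1) * ((1 - r\<^sup>2) powr \<alpha> * (F (r\<^sup>2) * G (r\<^sup>2) * r ^ (k + l))))
      *\<^sub>R (LINT \<omega>|sphere_measure. cl_conj (Y \<omega>) \<odot> Z \<omega>)"
proof -
  let ?\<phi> = "\<lambda>r. (1 - r\<^sup>2) powr \<alpha> * (F (r\<^sup>2) * G (r\<^sup>2) * r ^ (k + l))"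
  let ?h = "\<lambda>\<omega>. cl_conj (Y \<omega>) \<odot> Z \<omega>"
  have \<phi>: "set_integrable lborel {0<..<1} (\<lambda>r. r ^ (CARD('n) - 1) * ?\<phi> r)"
    by (intro set_integrable_radial_weight_mult \<alpha> m continuous_intros continuous_on_comp_power2 F G)
  have h: "integrable sphere_measure ?h"
    by (intro integrable_sphere_measure_continuous continuous_on_cl_conj_mult continuous_on_homogeneous_polynomial[OF Y]
        continuous_on_homogeneous_polynomial[OF Z])
  note int = set_integrable_polar[OF \<phi> h] and val = set_integral_polar[OF \<phi> h]
  have "ball_weight \<alpha> x *\<^sub>R (cl_conj (radial_times F Y x) \<odot> radial_times G Z x) = ?\<phi> (norm x) *\<^sub>R ?h (sgn x)" for x
    using monogenic_product_polar[OF Y Z, of x]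
    by (simp add: ball_weight_def radial_times_def cl_conj_scaleR cl.scaleR_left cl.scaleR_right mult_ac)
  then have "L2_ball_inner \<alpha> (radial_times F Y) (radial_times G Z) = (LINT x:ball 0 1|lebesgue. ?\<phi> (norm x) *\<^sub>R ?h (sgn x))"
    by (simp add: L2_ball_inner_def)
  also have "\<dots> = (LINT x:ball 0 1|lborel. ?\<phi> (norm x) *\<^sub>R ?h (sgn x))"
    unfolding set_lebesgue_integral_def
    by (rule integral_completion) (use borel_measurable_integrable[OF int[unfolded set_integrable_def]] in simp)
  finally show ?thesis unfolding val .
qed

lemma radial_times_in_L2_ball:
  fixes Y :: "'n point \<Rightarrow> 'n::{finite,linorder} multivector"
  assumes m: "CARD('n) \<ge> 2" and \<alpha>: "\<alpha> > -1"
    and F: "continuous_on {0..1} F" and Y: "homogeneous_polynomial k Y"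
  shows "radial_times F Y \<in> L2_ball \<alpha>"
proof -
  let ?\<phi> = "\<lambda>r. (1 - r\<^sup>2) powr \<alpha> * (F (r\<^sup>2) * F (r\<^sup>2) * r ^ (k + k))"
  let ?h = "\<lambda>\<omega>. (norm (Y \<omega>))\<^sup>2"
  have \<phi>: "set_integrable lborel {0<..<1} (\<lambda>r. r ^ (CARD('n) - 1) * ?\<phi> r)"
    by (intro set_integrable_radial_weight_mult \<alpha> m continuous_intros continuous_on_comp_power2 F)
  have h: "integrable sphere_measure ?h"
    by (intro integrable_sphere_measure_continuous continuous_intros continuous_on_homogeneous_polynomial[OF Y])
  have "(norm (radial_times F Y x))\<^sup>2 * ball_weight \<alpha> x = ?\<phi> (norm x) *\<^sub>R ?h (sgn x)" for x
  proof -
    have "x = norm x *\<^sub>R sgn x" by (cases "x = 0") (simp_all add: sgn_div_norm)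
    then have "Y x = norm x ^ k *\<^sub>R Y (sgn x)"
      using homogeneous_polynomial_scale[OF Y, of "norm x" "sgn x"] by simp
    then show ?thesis
      by (simp add: ball_weight_def radial_times_def power_mult_distrib power_add power2_eq_square mult_ac)
  qed
  then have "set_integrable lborel (ball 0 1) (\<lambda>x. (norm (radial_times F Y x))\<^sup>2 * ball_weight \<alpha> x)"
    using set_integrable_polar[OF \<phi> h] by simp
  then have int: "set_integrable lebesgue (ball 0 1) (\<lambda>x. (norm (radial_times F Y x))\<^sup>2 * ball_weight \<alpha> x)"
    unfolding set_integrable_def
    by (subst integrable_completion) (auto dest: borel_measurable_integrable)
  have "continuous_on (ball 0 1) (\<lambda>x::'n point. F ((norm x)\<^sup>2))"
    by (rule continuous_on_compose2[OF F]) (auto intro!: continuous_intros simp: power_le_one)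
  then have "continuous_on (ball 0 1) (radial_times F Y)"
    unfolding radial_times_def[abs_def]
    by (intro continuous_intros continuous_on_homogeneous_polynomial[OF Y])
  from borel_measurable_continuous_on_indicator[OF _ this]
  have "set_borel_measurable lebesgue (ball 0 1) (radial_times F Y)"
    unfolding set_borel_measurable_def by (intro measurable_completion) simp
  with int show ?thesis by (simp add: L2_ball_def)
qed

theorem lemma5p4:
  fixes c \<alpha> :: real
    and Y :: "nat \<Rightarrow> nat \<Rightarrow> 'n point \<Rightarrow> 'n::{finite,linorder} multivector"
    and P :: "nat \<Rightarrow> nat \<Rightarrow> real \<Rightarrow> real"
    and \<psi> :: "nat \<Rightarrow> nat \<Rightarrow> nat \<Rightarrow> 'n point \<Rightarrow> 'n multivector"
  assumes "CARD('n) \<ge> 2" and "c \<ge> 0" and "\<alpha> > -1"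
    and "\<And>k. monogenic_onb k (Y k)"
    and "\<And>k i. i \<in> {1..monogenic_dim TYPE('n) k} \<Longrightarrow> even_cpswf_enumeration c \<alpha> (Y k i) (P k)"
    and "\<And>N k i x. \<psi> N k i x = radial_times (P k N) (Y k i) x"
  shows "(\<forall>N k. \<forall>i\<in>{1..monogenic_dim TYPE('n) k}. \<psi> N k i \<in> L2_ball \<alpha>) \<and>
    (\<forall>N k. \<forall>i\<in>{1..monogenic_dim TYPE('n) k}. \<forall>N' k'. \<forall>i'\<in>{1..monogenic_dim TYPE('n) k'}.
       (N, k, i) \<noteq> (N', k', i') \<longrightarrow> L2_ball_inner \<alpha> (\<psi> N k i) (\<psi> N' k' i') = 0)"
proof -
  let ?I = "\<lambda>k. {1..monogenic_dim TYPE('n) k}"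
  have \<psi>: "\<psi> N k i = radial_times (P k N) (Y k i)" for N k i
    using assms(6) by (rule ext)
  have mono: "Y k i \<in> monogenics k" if "i \<in> ?I k" for k i
    using assms(4)[of k] that unfolding monogenic_onb_def by blast
  have orth: "(LINT \<omega>|sphere_measure. cl_conj (Y k i \<omega>) \<odot> Y k i' \<omega>) = 0"
    if "i \<in> ?I k" "i' \<in> ?I k" "i \<noteq> i'" for k i i'
    using assms(4)[of k] that unfolding monogenic_onb_def by simp
  have hom: "homogeneous_polynomial k (Y k i)" if "i \<in> ?I k" for k i
    using mono[OF that] by (simp add: monogenics_def)
  have cont: "continuous_on {0..1} (P k N)" if "i \<in> ?I k" for k i N
    using assms(5)[OF that] unfolding even_cpswf_enumeration_def even_cpswf_radial_def
    by (blast intro: smooth_unit_interval_continuous)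
  have "\<psi> N k i \<in> L2_ball \<alpha>" if "i \<in> ?I k" for N k i
    unfolding \<psi> by (rule radial_times_in_L2_ball[OF assms(1,3) cont[OF that] hom[OF that]])
  moreover have "L2_ball_inner \<alpha> (\<psi> N k i) (\<psi> N' k' i') = 0"
    if i: "i \<in> ?I k" and i': "i' \<in> ?I k'" and ne: "(N, k, i) \<noteq> (N', k', i')" for N k i N' k' i'
  proof -
    note polar = L2_ball_inner_radial_times[OF assms(1,3) cont[OF i, of N] cont[OF i', of N'] hom[OF i] hom[OF i']]
    consider "k \<noteq> k'" | "k = k'" "i \<noteq> i'" | "k = k'" "i = i'" "N \<noteq> N'" using ne by blast
    then show ?thesis
    proof cases
      case 1
      then show ?thesis
        unfolding \<psi> polar monogenics_orthogonal[OF mono[OF i] mono[OF i'] 1] by simp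
    next
      case 2
      then have "(LINT \<omega>|sphere_measure. cl_conj (Y k i \<omega>) \<odot> Y k' i' \<omega>) = 0"
        using orth i i' by blast
      then show ?thesis unfolding \<psi> polar by simp
    next
      case 3
      obtain ev where ev: "\<And>N. even_cpswf_radial c \<alpha> (Y k i) (ev N) (P k N)"
        using assms(5)[OF i] unfolding even_cpswf_enumeration_def by blast
      have "ev N \<noteq> ev N'"
        using enumerated_eigenvalue_simple[OF assms(5)[OF i] mono[OF i] ev[of N]] ev[of N'] 3 by metis
      from even_cpswf_radial_orthogonal[OF assms(1,3) ev ev mono[OF i] this]
      show ?thesis unfolding \<psi> polar using 3 by simp
    qed
  qed
  ultimately show ?thesis by blast
qed

end
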